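(* Let $\gamma(s)\subset K$, $s\in(-\infty,+\infty)$, be a non-radial geodesic with $I=1$ and $\|\gamma'(s)\|=1$. 1) The geodesic $\gamma(s)$ is tangent to $\mathbb{S}^N$ at a unique point $\gamma(s_0)$. Its radial projection $$\tilde\gamma(\tilde s)=\frac{\gamma(s)}{\|\gamma(s)\|}\subset\Sigma,$$ where $$s=\tan\tilde s,\qquad \tilde s\in\left(-\frac{\pi}{2},\frac{\pi}{2}\right),$$ is a geodesic in $\Sigma$, and $\tilde s$ is the arc-length parameter of $\tilde\gamma$, $\|\tilde\gamma'(\tilde s)\|=1$. 2) Conversely, let $\tilde\gamma(\tilde s)$, $\tilde s\in\left(-\frac{\pi}{2},\frac{\pi}{2}\right)$, be an interval of a geodesic on $\Sigma$ of length $\pi$, with $\tilde s$ as its arc-length parameter. Then $$\gamma(s)=\tilde\gamma(\tilde s)\sqrt{s^2+1},\qquad \tilde s=\arctan s,\qquad s\in(-\infty,+\infty),$$ is a geodesic on $K$, with $s$ as its arc-length parameter, $\|\gamma'(s)\|=1$, touching $\mathbb{S}^N$ at $\tilde\gamma(0)=\gamma(0)$. 3) The following limits exist: $$\lim_{s\to+\infty}\gamma'(s)=\lim_{s\to+\infty}\frac{\gamma(s)}{\|\gamma(s)\|}=\tilde\gamma\left(\frac{\pi}{2}\right)\in K,$$ $$\lim_{s\to-\infty}\gamma'(s)=-\lim_{s\to-\infty}\frac{\gamma(s)}{\|\gamma(s)\|}=-\tilde\gamma\left(-\frac{\pi}{2}\right)\in K.$$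
   Context: Let $\Gamma$ be a closed $C^3$ Riemannian manifold, $\dim\Gamma=n$, isometrically embedded in the affine hyperplane $\{x^{N+1}=1\}\subset\mathbb{R}^{N+1}$ for some $N>n$. The cone over $\Gamma$ is $K=\{tp\mid p\in\Gamma,\ t\in\mathbb{R}\}\subset\mathbb{R}^{N+1}$, equipped with the metric induced by the Euclidean metric of $\mathbb{R}^{N+1}$; $O$ (the point $t=0$) is its vertex. $\mathbb{S}^N\subset\mathbb{R}^{N+1}$ is the unit sphere centered at $O$, and $\Sigma=K\cap\mathbb{S}^N$, $\dim\Sigma=n$, carries the induced metric. A radial geodesic on $K$ is a generatrix of the cone, i.e. a line through $O$; all other geodesics are non-radial. The quantity $$I=\|\gamma(s)\|^2-\frac{\langle\gamma(s),\gamma'(s)\rangle^2}{\|\gamma'(s)\|^2}$$ is constant along every geodesic $\gamma$ on $K$ (it is the squared distance from $O$ to the tangent line of $\gamma$). Non-radial geodesics have $I>0$ and are defined for all $s\in(-\infty,+\infty)$; since $a_1\gamma(a_2s)$, $a_1,a_2\in\mathbb{R}\setminus\{0\}$, is again a geodesic, the normalization $I=1$, $\|\gamma'(s)\|=1$ is without loss of generality. The values $\tilde\gamma(\pm\frac{\pi}{2})$ are those of the extension of $\tilde\gamma$ as a geodesic of $\Sigma$, which is closed and hence geodesically complete.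
   Formalization: In part 1 (and so in part 3) the substitution s = tan s̃ is replaced by s = s₀ + tan s̃, where γ(s₀) is the tangency point; the formula as written gives an arc-length parameter only if s₀ = 0. *)

theory Defs
  imports "HOL-Analysis.Analysis"
begin

(* C^k on an open set, by iterated directional derivatives; in finite dimension
   this agrees with continuity of the iterated Frechet derivatives. *)
primrec Ck_on ::
  "nat \<Rightarrow> ('a::real_normed_vector \<Rightarrow> 'b::real_normed_vector) \<Rightarrow> 'a set \<Rightarrow> bool" where
  "Ck_on 0 f U \<longleftrightarrow> continuous_on U f"
| "Ck_on (Suc k) f U \<longleftrightarrow>
     (\<forall>x\<in>U. f differentiable (at x)) \<and>
     (\<forall>v. Ck_on k (\<lambda>x. frechet_derivative f (at x) v) U)"

(* Embedded n-dimensional C^k submanifold without boundary of a Euclidean space: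
   locally flattened onto an n-dimensional linear subspace S by a C^k diffeomorphism
   f : U -> V with inverse g. *)
definition Ck_submanifold :: "nat \<Rightarrow> nat \<Rightarrow> 'a::euclidean_space set \<Rightarrow> bool" where
  "Ck_submanifold k n M \<longleftrightarrow>
     (\<forall>p\<in>M. \<exists>U V (f :: 'a \<Rightarrow> 'a) g S.
        open U \<and> p \<in> U \<and> open V \<and> f ` U = V \<and> (\<forall>x\<in>U. g (f x) = x) \<and>
        Ck_on k f U \<and> Ck_on k g V \<and>
        subspace S \<and> dim S = n \<and> f ` (M \<inter> U) = S \<inter> V)"

definition closed_Ck_submanifold :: "nat \<Rightarrow> nat \<Rightarrow> 'a::euclidean_space set \<Rightarrow> bool" where
  "closed_Ck_submanifold k n M \<longleftrightarrow> compact M \<and> Ck_submanifold k n M"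

(* Velocities at p of curves in M.  On a C^1 submanifold this is the usual tangent space;
   differentiability of the curve at the single parameter 0 gives no further vectors. *)
definition tangent_vectors :: "'a::real_normed_vector set \<Rightarrow> 'a \<Rightarrow> 'a set" where
  "tangent_vectors M p =
     {v. \<exists>c e. e > 0 \<and> c 0 = p \<and> (\<forall>t\<in>{-e<..<e}. c t \<in> M) \<and>
           (c has_vector_derivative v) (at 0)}"

definition velocity :: "(real \<Rightarrow> 'a::real_normed_vector) \<Rightarrow> real \<Rightarrow> 'a" where
  "velocity c s = vector_derivative c (at s)"

(* Geodesics, parametrized by an open set J, for the metric on M induced by the ambient
   Euclidean metric.  The Levi-Civita covariant derivative of c' along c is the tangential
   part of c'', so the geodesic equation says that c'' is normal to M.  The definition is
   also applied to the cone: away from the vertex it is a submanifold, and lines through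
   the vertex satisfy the equation at the vertex as well, because there c'' = 0. *)
definition geodesic_on :: "'a::real_inner set \<Rightarrow> real set \<Rightarrow> (real \<Rightarrow> 'a) \<Rightarrow> bool" where
  "geodesic_on M J c \<longleftrightarrow>
     (\<forall>s\<in>J. c s \<in> M \<and> c differentiable (at s) \<and> velocity c differentiable (at s) \<and>
        (\<forall>w \<in> tangent_vectors M (c s). velocity (velocity c) s \<bullet> w = 0)) \<and>
     continuous_on J (velocity (velocity c))"

definition complete_geodesic_extension ::
  "'a::real_inner set \<Rightarrow> real set \<Rightarrow> (real \<Rightarrow> 'a) \<Rightarrow> (real \<Rightarrow> 'a) \<Rightarrow> bool" where
  "complete_geodesic_extension M J c d \<longleftrightarrow> geodesic_on M UNIV d \<and> (\<forall>t\<in>J. d t = c t)"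

definition unit_speed_on :: "real set \<Rightarrow> (real \<Rightarrow> 'a::real_normed_vector) \<Rightarrow> bool" where
  "unit_speed_on J c \<longleftrightarrow> (\<forall>s\<in>J. norm (velocity c s) = 1)"

definition cone_over :: "'a::real_vector set \<Rightarrow> 'a set" where
  "cone_over G = {t *\<^sub>R p | t p. p \<in> G}"

definition cone_link :: "'a::real_normed_vector set \<Rightarrow> 'a set" where
  "cone_link G = cone_over G \<inter> sphere 0 1"

definition radial :: "'a::real_vector set \<Rightarrow> (real \<Rightarrow> 'a) \<Rightarrow> bool" where
  "radial G c \<longleftrightarrow> (\<exists>p\<in>G. range c \<subseteq> {t *\<^sub>R p | t. True})"

definition cone_integral :: "(real \<Rightarrow> 'a::real_inner) \<Rightarrow> real \<Rightarrow> real" where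
  "cone_integral c s = (norm (c s))\<^sup>2 - (c s \<bullet> velocity c s)\<^sup>2 / (norm (velocity c s))\<^sup>2"

definition tangent_to_sphere_at :: "(real \<Rightarrow> 'a::real_normed_vector) \<Rightarrow> real \<Rightarrow> bool" where
  "tangent_to_sphere_at c s \<longleftrightarrow>
     c s \<in> sphere 0 1 \<and> velocity c s \<in> tangent_vectors (sphere 0 1) (c s)"

(* The radial projection in the parameter t with s = s0 + tan t.  The parameter s of a
   unit-speed geodesic is only determined up to a shift, and t is an arc-length parameter
   of the projection precisely when s is measured from the point of tangency with the
   sphere; s0 is the parameter value of that point (s0 = 0 gives s = tan t). *)
definition radial_projection ::
  "(real \<Rightarrow> 'a::real_normed_vector) \<Rightarrow> real \<Rightarrow> real \<Rightarrow> 'a" where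
  "radial_projection c s0 t = c (s0 + tan t) /\<^sub>R norm (c (s0 + tan t))"

definition conical_lift :: "(real \<Rightarrow> 'a::real_vector) \<Rightarrow> real \<Rightarrow> 'a" where
  "conical_lift d s = sqrt (s\<^sup>2 + 1) *\<^sub>R d (arctan s)"

abbreviation proj_interval :: "real set" where
  "proj_interval \<equiv> {- (pi / 2)<..<pi / 2}"

end

theory Submission
  imports Defs
begin

text \<open>
Everything except the extension of \<open>\<gamma>\<close>'s projection to all times is a computation.  The position
vector \<open>\<gamma> s\<close> is itself tangent to the cone, so the acceleration of a geodesic \<open>\<gamma>\<close> of the cone is
orthogonal to it, and \<open>\<gamma> s \<bullet> \<gamma>' s\<close> has derivative \<open>1\<close>.  Hence this product is \<open>s - s0\<close> for one number
\<open>s0\<close>, and the normalization \<open>I = 1\<close> reads \<open>\<parallel>\<gamma> s\<parallel>\<^sup>2 = 1 + (s - s0)\<^sup>2\<close>: the curve meets the unit sphere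
only at \<open>s0\<close>, and tangentially.  With \<open>s = s0 + tan t\<close> the projection is \<open>cos t *\<^sub>R \<gamma> s\<close>, whose
second derivative is the sum of minus the projection (normal to the sphere) and
\<open>(cos t) powi -3\<close> times the acceleration of \<open>\<gamma>\<close> (normal to the cone); so it is normal to the link.
The lift is the inverse computation: \<open>\<gamma>''\<close> is a multiple of \<open>\<delta> + \<delta>''\<close>, where \<open>\<delta>\<close> cancels the radial
component \<open>-1\<close> of \<open>\<delta>''\<close>.  Finally \<open>\<gamma>' = cos t *\<^sub>R \<delta>' t + sin t *\<^sub>R \<delta> t\<close> for the projection \<open>\<delta>\<close>, and the
limits are obtained by letting \<open>t\<close> tend to \<open>\<plusminus> pi / 2\<close> in an extension of \<open>\<delta>\<close>.

That an extension exists is geodesic completeness of the link, a closed \<open>C\<^sup>3\<close> submanifold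
(lemmas \<open>closed_Ck_submanifold_cone_link\<close> and \<open>closed_submanifold_geodesically_complete\<close>).  In a chart
\<open>g\<close> over a subspace \<open>S\<close> the geodesic equation becomes \<open>u' = w\<close>, \<open>w' = accel u w\<close>, where \<open>accel u w\<close> is the
unique element of \<open>S\<close> that makes \<open>Dg u (accel u w) + D\<^sup>2g u (w, w)\<close> normal to the image of
\<open>S\<close>.  This field is locally Lipschitz because \<open>g\<close> is \<open>C\<^sup>3\<close>, so the Picard iteration solves it and
solutions are unique.  A unit speed geodesic stays in a compact part of a chart for a time that
depends only on that part, and by compactness of the manifold one duration \<open>T\<close> serves for all
geodesics.  Restarting less than \<open>T\<close> before the end of its interval continues any unit speed
geodesic past the end by a fixed amount, and countably many such steps exhaust the line.
\<close>

section \<open>Calculus of iterated directional derivatives\<close>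

lemma Ck_on_subset: "Ck_on k f U \<Longrightarrow> W \<subseteq> U \<Longrightarrow> Ck_on k f W"
proof (induction k arbitrary: f)
  case 0
  then show ?case by (auto intro: continuous_on_subset)
next
  case (Suc k)
  then show ?case by (auto simp: subset_iff)
qed

lemma Ck_on_has_derivative:
  assumes "Ck_on (Suc k) f U" "x \<in> U"
  shows "(f has_derivative frechet_derivative f (at x)) (at x)"
  using assms frechet_derivative_works by auto

lemma Ck_on_frechet: "Ck_on (Suc k) f U \<Longrightarrow> Ck_on k (\<lambda>x. frechet_derivative f (at x) v) U"
  by simp

lemma Ck_on_SucD: "Ck_on (Suc k) f U \<Longrightarrow> Ck_on k f U"
proof (induction k arbitrary: f)
  case 0
  then show ?case
    by (auto intro!: continuous_at_imp_continuous_on differentiable_imp_continuous_within)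
next
  case (Suc k)
  then show ?case by (metis Ck_on.simps(2))
qed

lemma Ck_on_le: "Ck_on m f U \<Longrightarrow> k \<le> m \<Longrightarrow> Ck_on k f U"
  by (induction m) (auto simp: le_Suc_eq dest: Ck_on_SucD simp del: Ck_on.simps)

lemma Ck_on_continuous: "Ck_on k f U \<Longrightarrow> continuous_on U f"
  using Ck_on_le[of k f U 0] by simp

lemma Ck_on_cong:
  assumes "open U" "\<And>x. x \<in> U \<Longrightarrow> f x = g x" "Ck_on k f U"
  shows "Ck_on k g U"
  using assms(2,3)
proof (induction k arbitrary: f g)
  case 0
  then show ?case by (metis Ck_on.simps(1) continuous_on_cong)
next
  case (Suc k)
  have D: "(g has_derivative frechet_derivative f (at x)) (at x)" if "x \<in> U" for x
    using has_derivative_transform_within_open[OF Ck_on_has_derivative[OF Suc.prems(2) that] \<open>open U\<close> that]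
      Suc.prems(1) by blast
  then have "frechet_derivative f (at x) = frechet_derivative g (at x)" if "x \<in> U" for x
    using frechet_derivative_at that by blast
  then have "Ck_on k (\<lambda>x. frechet_derivative g (at x) v) U" for v
    using Suc.IH[of "\<lambda>x. frechet_derivative f (at x) v" "\<lambda>x. frechet_derivative g (at x) v"] Suc.prems(2)
    by auto
  with D show ?case by (auto simp: differentiable_def)
qed

text \<open>Derivatives are usually available in closed form; this rule lets an induction on the order of
differentiability work with the closed form instead of with \<open>frechet_derivative\<close>.\<close>
lemma Ck_on_SucI:
  assumes "open U" "\<And>x. x \<in> U \<Longrightarrow> (f has_derivative D x) (at x)" "\<And>v. Ck_on k (\<lambda>x. D x v) U"
  shows "Ck_on (Suc k) f U"
proof -
  have "Ck_on k (\<lambda>x. frechet_derivative f (at x) v) U" for v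
    by (rule Ck_on_cong[OF assms(1) _ assms(3)[of v]]) (metis assms(2) frechet_derivative_at)
  with assms(2) show ?thesis by (auto simp: differentiable_def)
qed

lemma Ck_on_const: "open U \<Longrightarrow> Ck_on k (\<lambda>x. c) U"
proof (induction k arbitrary: c)
  case (Suc k)
  show ?case by (rule Ck_on_SucI[where D="\<lambda>x v. 0"]) (use Suc in auto)
qed simp

lemma Ck_on_bounded_linear:
  assumes "open U" "bounded_linear L" shows "Ck_on k L U"
proof (cases k)
  case 0
  then show ?thesis using assms linear_continuous_on by auto
next
  case (Suc m)
  show ?thesis unfolding Suc
    by (rule Ck_on_SucI[where D="\<lambda>x. L"])
      (use assms in \<open>auto intro: bounded_linear_imp_has_derivative Ck_on_const\<close>)
qed

lemma Ck_on_add: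
  assumes "open U" "Ck_on k f U" "Ck_on k g U"
  shows "Ck_on k (\<lambda>x. f x + g x) U"
  using assms(2,3)
proof (induction k arbitrary: f g)
  case 0
  then show ?case by (auto intro: continuous_on_add)
next
  case (Suc k)
  show ?case
    by (rule Ck_on_SucI[OF assms(1) has_derivative_add[OF Ck_on_has_derivative[OF Suc.prems(1)]
            Ck_on_has_derivative[OF Suc.prems(2)]]]) (use Suc in auto)
qed

lemma Ck_on_sum:
  assumes "open U" "finite I" "\<And>i. i \<in> I \<Longrightarrow> Ck_on k (f i) U"
  shows "Ck_on k (\<lambda>x. \<Sum>i\<in>I. f i x) U"
  using assms(2,3) by (induction I rule: finite_induct) (auto intro: Ck_on_const Ck_on_add assms(1))

lemma Ck_on_bilinear:
  assumes "bounded_bilinear B" "open U" "Ck_on k f U" "Ck_on k g U"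
  shows "Ck_on k (\<lambda>x. B (f x) (g x)) U"
  using assms(3,4)
proof (induction k arbitrary: f g)
  case 0
  then show ?case using bounded_bilinear.continuous_on[OF assms(1)] by auto
next
  case (Suc k)
  show ?case
    by (rule Ck_on_SucI[OF assms(2) bounded_bilinear.FDERIV[OF assms(1)
            Ck_on_has_derivative[OF Suc.prems(1)] Ck_on_has_derivative[OF Suc.prems(2)]]])
      (use Suc in \<open>auto intro!: Ck_on_add assms(2) Suc.IH intro: Ck_on_SucD[unfolded Ck_on.simps]
        dest: Ck_on_frechet Ck_on_SucD simp del: Ck_on.simps\<close>)
qed

lemma linear_basis_expansion:
  fixes L :: "'a::euclidean_space \<Rightarrow> 'b::real_normed_vector"
  assumes "bounded_linear L"
  shows "L v = (\<Sum>b\<in>Basis. (v \<bullet> b) *\<^sub>R L b)"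
proof -
  have "L v = L (\<Sum>b\<in>Basis. (v \<bullet> b) *\<^sub>R b)" by (simp add: euclidean_representation)
  also have "\<dots> = (\<Sum>b\<in>Basis. (v \<bullet> b) *\<^sub>R L b)"
    using assms by (simp add: linear_sum linear_cmul bounded_linear.linear)
  finally show ?thesis .
qed

text \<open>By the chain rule a directional derivative of the composition is a sum, over a basis, of
components of the derivative of \<open>\<phi>\<close> times basis derivatives of \<open>f\<close> along \<open>\<phi>\<close>.  In this form only
directional derivatives in fixed directions occur, and the induction hypothesis applies to each.\<close>
lemma Ck_on_compose:
  fixes \<phi> :: "'a::real_normed_vector \<Rightarrow> 'b::euclidean_space"
    and f :: "'b \<Rightarrow> 'c::real_normed_vector"
  assumes "open U" "open W" "\<phi> ` U \<subseteq> W" "Ck_on k f W" "Ck_on k \<phi> U"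
  shows "Ck_on k (\<lambda>x. f (\<phi> x)) U"
  using assms(4,5)
proof (induction k arbitrary: f)
  case 0
  then show ?case using assms(3) by (auto intro: continuous_on_compose2)
next
  case (Suc k)
  let ?D = "\<lambda>x v. \<Sum>b\<in>Basis. (frechet_derivative \<phi> (at x) v \<bullet> b) *\<^sub>R frechet_derivative f (at (\<phi> x)) b"
  show ?case
  proof (rule Ck_on_SucI[OF assms(1), where D = ?D])
    fix x assume x: "x \<in> U"
    then have f: "(f has_derivative frechet_derivative f (at (\<phi> x))) (at (\<phi> x))"
      using Ck_on_has_derivative[OF Suc.prems(1)] assms(3) by blast
    have "((\<lambda>x. f (\<phi> x)) has_derivative (\<lambda>v. frechet_derivative f (at (\<phi> x)) (frechet_derivative \<phi> (at x) v))) (at x)"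
      using has_derivative_compose[OF Ck_on_has_derivative[OF Suc.prems(2) x] f] .
    then show "((\<lambda>x. f (\<phi> x)) has_derivative ?D x) (at x)"
      by (simp only: linear_basis_expansion[OF has_derivative_bounded_linear[OF f], symmetric])
  next
    fix v
    show "Ck_on k (\<lambda>x. ?D x v) U"
    proof (rule Ck_on_sum[OF assms(1) finite_Basis], rule Ck_on_bilinear[OF bounded_bilinear_scaleR assms(1)])
      fix b :: 'b
      show "Ck_on k (\<lambda>x. frechet_derivative \<phi> (at x) v \<bullet> b) U"
        by (rule Ck_on_bilinear[OF bounded_bilinear_inner assms(1) Ck_on_frechet[OF Suc.prems(2)] Ck_on_const[OF assms(1)]])
      show "Ck_on k (\<lambda>x. frechet_derivative f (at (\<phi> x)) b) U"
        by (rule Suc.IH[OF Ck_on_frechet[OF Suc.prems(1)] Ck_on_SucD[OF Suc.prems(2)]])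
    qed
  qed
qed

lemma Ck_on_mult:
  fixes f g :: "'a::real_normed_vector \<Rightarrow> real"
  shows "open U \<Longrightarrow> Ck_on k f U \<Longrightarrow> Ck_on k g U \<Longrightarrow> Ck_on k (\<lambda>x. f x * g x) U"
  by (rule Ck_on_bilinear[OF bounded_bilinear_mult])

text \<open>The derivative is a polynomial in \<open>inverse\<close> itself, so the induction feeds on its own conclusion.
The same holds for \<open>sqrt\<close> below, with \<open>inverse \<circ> sqrt\<close> in place of \<open>inverse\<close>.\<close>
lemma Ck_on_inverse: "Ck_on k (inverse :: real \<Rightarrow> real) (- {0})"
proof (induction k)
  case 0
  then show ?case by (auto intro: continuous_on_inverse)
next
  case (Suc k)
  show ?case
  proof (rule Ck_on_SucI[where D="\<lambda>x h. - 1 * (inverse x * h * inverse x)"])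
    show "Ck_on k (\<lambda>x. - 1 * (inverse x * v * inverse x)) (- {0})" for v :: real
      by (intro Ck_on_mult Ck_on_const Suc) auto
  qed (auto intro!: derivative_eq_intros)
qed

lemma Ck_on_sqrt: "Ck_on k sqrt {0<..}"
proof (induction k)
  case 0
  then show ?case by (auto intro: continuous_intros)
next
  case (Suc k)
  have inv: "Ck_on k (\<lambda>x. inverse (sqrt x)) {0<..}"
    by (rule Ck_on_compose[OF _ _ _ Ck_on_inverse Suc]) auto
  show ?case
  proof (rule Ck_on_SucI[where D="\<lambda>x h. (h / 2) * inverse (sqrt x)"])
    show "Ck_on k (\<lambda>x. (v / 2) * inverse (sqrt x)) {0<..}" for v :: real
      by (intro Ck_on_mult Ck_on_const inv) auto
  qed (auto intro!: derivative_eq_intros simp: field_simps)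
qed

lemma Ck_on_bounded_on_compact:
  assumes "Ck_on k f U" "compact K" "K \<subseteq> U"
  obtains C where "C > 0" "\<And>x. x \<in> K \<Longrightarrow> norm (f x) \<le> C"
  using compact_continuous_image[OF continuous_on_subset[OF Ck_on_continuous[OF assms(1)] assms(3)] assms(2)]
    compact_imp_bounded bounded_pos by (metis imageI)

lemma Ck_on_derivative_bounded_on_compact:
  fixes f :: "'a::euclidean_space \<Rightarrow> 'b::real_normed_vector"
  assumes f: "Ck_on (Suc k) f U" and K: "compact K" "K \<subseteq> U"
  obtains C where "C > 0" "\<And>x v. x \<in> K \<Longrightarrow> norm (frechet_derivative f (at x) v) \<le> C * norm v"
proof -
  have "\<exists>C>0. \<forall>x\<in>K. norm (frechet_derivative f (at x) b) \<le> C" for b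
    using Ck_on_bounded_on_compact[OF Ck_on_frechet[OF f] K] by metis
  then obtain C where C: "\<And>b. C b > 0" "\<And>b x. x \<in> K \<Longrightarrow> norm (frechet_derivative f (at x) b) \<le> C b"
    by metis
  have "norm (frechet_derivative f (at x) v) \<le> (\<Sum>b\<in>Basis. C b) * norm v" if x: "x \<in> K" for x v
  proof -
    have "bounded_linear (frechet_derivative f (at x))"
      using Ck_on_has_derivative[OF f] x K has_derivative_bounded_linear by blast
    then have "norm (frechet_derivative f (at x) v) = norm (\<Sum>b\<in>Basis. (v \<bullet> b) *\<^sub>R frechet_derivative f (at x) b)"
      using linear_basis_expansion by metis
    also have "\<dots> \<le> (\<Sum>b\<in>Basis. norm v * C b)"
      by (rule sum_norm_le) (auto intro!: mult_mono C x Basis_le_norm)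
    finally show ?thesis by (simp add: sum_distrib_left mult.commute)
  qed
  moreover have "(\<Sum>b\<in>(Basis::'a set). C b) > 0" by (intro sum_pos C) auto
  ultimately show thesis using that by blast
qed

text \<open>Convexity makes the mean value inequality available along the segment between the two points.\<close>
lemma Ck_on_lipschitz_on_compact_convex:
  fixes f :: "'a::euclidean_space \<Rightarrow> 'b::real_normed_vector"
  assumes f: "Ck_on (Suc k) f U" and K: "compact K" "K \<subseteq> U" "convex K"
  obtains C where "C > 0" "\<And>x y. x \<in> K \<Longrightarrow> y \<in> K \<Longrightarrow> norm (f x - f y) \<le> C * norm (x - y)"
proof -
  obtain C where C: "C > 0" "\<And>x v. x \<in> K \<Longrightarrow> norm (frechet_derivative f (at x) v) \<le> C * norm v"
    using Ck_on_derivative_bounded_on_compact[OF f K(1,2)] by blast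
  have "norm (f x - f y) \<le> C * norm (x - y)" if "x \<in> K" "y \<in> K" for x y
  proof (rule differentiable_bound[OF K(3) _ _ that(1,2)])
    fix z assume z: "z \<in> K"
    then show "(f has_derivative frechet_derivative f (at z)) (at z within K)"
      using Ck_on_has_derivative[OF f] K has_derivative_at_withinI by blast
    show "onorm (frechet_derivative f (at z)) \<le> C"
      using C z by (intro onorm_le) auto
  qed
  with C(1) show thesis using that by blast
qed

section \<open>Lipschitz differential equations\<close>

text \<open>The fixed point of the Picard operator.  The operator acts on bounded continuous functions on the
whole line, with time clamped to \<open>{0..T}\<close>, because these form a complete metric space; on an interval with \<open>T * C \<le> 1 / 2\<close> it halves distances.\<close>
lemma picard_lindeloef_lipschitz:
  fixes F :: "'b::euclidean_space \<Rightarrow> 'b"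
  assumes lip: "\<And>x y. norm (F x - F y) \<le> C * norm (x - y)" and T: "0 < T" "T * C \<le> 1 / 2"
  obtains X where "X 0 = x0"
    "\<And>t. t \<in> {0..T} \<Longrightarrow> (X has_vector_derivative F (X t)) (at t within {0..T})"
proof -
  have "0 \<le> C"
  proof -
    obtain b :: 'b where b: "b \<in> Basis" using nonempty_Basis by blast
    show ?thesis using order_trans[OF norm_ge_zero lip[of b 0]] b by simp
  qed
  then have F: "continuous_on UNIV F"
    using lip by (intro lipschitz_on_continuous_on[of C] lipschitz_onI) (auto simp: dist_norm)
  define P where "P X t = x0 + integral {0..t} (\<lambda>s. F (X s))" for X :: "real \<Rightarrow> 'b" and t
  have cont_FX: "continuous_on {0..T} (\<lambda>s. F (apply_bcontfun X s))" for X
    by (rule continuous_on_compose2[OF F]) (auto intro: continuous_on_subset continuous_on_apply_bcontfun)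
  have int_FX: "(\<lambda>s. F (apply_bcontfun X s)) integrable_on {0..t}" if "t \<le> T" for X t
    by (rule integrable_continuous_interval, rule continuous_on_subset[OF cont_FX]) (use that in auto)
  have contP: "continuous_on (cbox 0 T) (P (apply_bcontfun X))" for X
    unfolding P_def using T int_FX[of T X]
    by (auto intro!: continuous_intros indefinite_integral_continuous_1)
  define \<Phi> where "\<Phi> X = Bcontfun (ext_cont (P (apply_bcontfun X)) 0 T)" for X
  have app: "apply_bcontfun (\<Phi> X) = ext_cont (P (apply_bcontfun X)) 0 T" for X
    unfolding \<Phi>_def
  proof (rule Bcontfun_inverse)
    show "ext_cont (P (apply_bcontfun X)) 0 T \<in> bcontfun"
      unfolding bcontfun_def
      using clamp_bounded[OF compact_imp_bounded[OF compact_continuous_image[OF contP[of X] compact_cbox]]]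
        continuous_on_ext_cont[OF contP[of X], of UNIV]
      by (auto simp: ext_cont_def)
  qed
  have "\<exists>!X. \<Phi> X = X"
  proof (rule banach_fix_type[of "1/2"])
    show "\<forall>X Y. dist (\<Phi> X) (\<Phi> Y) \<le> 1 / 2 * dist X Y"
    proof (intro allI dist_bound)
      fix X Y t
      define \<tau> where "\<tau> = clamp 0 T t"
      have \<tau>: "0 \<le> \<tau>" "\<tau> \<le> T"
        using clamp_in_interval[of 0 T t] T by (auto simp: \<tau>_def)
      have "dist (apply_bcontfun (\<Phi> X) t) (apply_bcontfun (\<Phi> Y) t)
          = norm (integral {0..\<tau>} (\<lambda>s. F (X s) - F (Y s)))"
        using \<tau> int_FX by (simp add: app ext_cont_def P_def \<tau>_def[symmetric] dist_norm integral_diff)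
      also have "\<dots> \<le> (C * dist X Y) * (\<tau> - 0)"
      proof (rule integral_bound)
        show "continuous_on {0..\<tau>} (\<lambda>s. F (X s) - F (Y s))"
          using continuous_on_subset[OF cont_FX] \<tau> by (intro continuous_on_diff) auto
        fix s
        have "norm (F (X s) - F (Y s)) \<le> C * norm (X s - Y s)" by (rule lip)
        also have "\<dots> \<le> C * dist X Y"
          using dist_bounded[of X s Y] \<open>0 \<le> C\<close> by (intro mult_left_mono) (auto simp: dist_norm)
        finally show "norm (F (X s) - F (Y s)) \<le> C * dist X Y" .
      qed (use \<tau> in auto)
      also have "\<dots> \<le> 1 / 2 * dist X Y"
      proof -
        have "C * \<tau> \<le> C * T" using \<open>0 \<le> C\<close> \<tau> by (intro mult_left_mono) auto
        then have "C * \<tau> \<le> 1 / 2" using T by (simp add: mult.commute)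
        then show ?thesis using \<open>0 \<le> C\<close> mult_right_mono[of "C * \<tau>" "1/2" "dist X Y"] by (simp add: ac_simps)
      qed
      finally show "dist (apply_bcontfun (\<Phi> X) t) (apply_bcontfun (\<Phi> Y) t) \<le> 1 / 2 * dist X Y" .
    qed
  qed auto
  then obtain X where X: "\<Phi> X = X" by blast
  have eq: "X t = P X t" if "t \<in> {0..T}" for t
    using arg_cong[OF X, of "\<lambda>X. apply_bcontfun X t"] that by (simp add: app ext_cont_def)
  show thesis
  proof
    show "X 0 = x0" using eq[of 0] T by (simp add: P_def)
    fix t assume t: "t \<in> {0..T}"
    have "((P X) has_vector_derivative F (X t)) (at t within {0..T})"
      unfolding P_def
      using integral_has_vector_derivative[OF cont_FX t, of X]
      by (auto intro!: derivative_eq_intros)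
    from has_vector_derivative_transform[OF t eq this]
    show "(X has_vector_derivative F (X t)) (at t within {0..T})" .
  qed
qed

text \<open>Gronwall's argument: the squared distance of two solutions, weighted by \<open>exp (- 2 * C * t)\<close>, does
not increase.  The equations are only assumed in the open interval, with continuity up to the
ends, because solutions with a one-sided start are compared.\<close>
lemma lipschitz_ode_unique:
  fixes F :: "'b::real_inner \<Rightarrow> 'b"
  assumes lip: "\<And>x y. norm (F x - F y) \<le> C * norm (x - y)"
    and cont: "continuous_on {a..b} x" "continuous_on {a..b} y"
    and x: "\<And>t. a < t \<Longrightarrow> t < b \<Longrightarrow> (x has_vector_derivative F (x t)) (at t)"
    and y: "\<And>t. a < t \<Longrightarrow> t < b \<Longrightarrow> (y has_vector_derivative F (y t)) (at t)"
    and "x a = y a" "a \<le> b"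
  shows "x b = y b"
proof -
  define q where "q t = exp (- 2 * C * t) * ((x t - y t) \<bullet> (x t - y t))" for t
  have "q b \<le> q a"
  proof (rule DERIV_nonpos_imp_decreasing_open[OF \<open>a \<le> b\<close>])
    show "continuous_on {a..b} q"
      unfolding q_def by (intro continuous_intros cont)
    fix t assume t: "a < t" "t < b"
    define z where "z = x t - y t"
    define w where "w = F (x t) - F (y t)"
    have "(q has_vector_derivative exp (- 2 * C * t) * (2 * (z \<bullet> w) - 2 * C * (z \<bullet> z))) (at t)"
      unfolding q_def has_vector_derivative_def z_def w_def
      by (rule derivative_eq_intros x[OF t, unfolded has_vector_derivative_def]
          y[OF t, unfolded has_vector_derivative_def] refl)+
        (auto simp: fun_eq_iff algebra_simps inner_diff_left inner_diff_right inner_commute)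
    moreover have "z \<bullet> w \<le> C * (z \<bullet> z)"
    proof -
      have "z \<bullet> w \<le> norm z * norm w" by (rule norm_cauchy_schwarz)
      also have "\<dots> \<le> norm z * (C * norm z)"
        using lip[of "x t" "y t"] by (intro mult_left_mono) (auto simp: z_def w_def)
      finally show ?thesis by (simp add: dot_square_norm power2_eq_square ac_simps)
    qed
    ultimately show "\<exists>d. DERIV q t :> d \<and> d \<le> 0"
      by (auto simp: has_real_derivative_iff_has_vector_derivative mult_le_0_iff intro!: exI)
  qed
  then have "(x b - y b) \<bullet> (x b - y b) \<le> 0"
    using assms(6) by (simp add: q_def mult_le_0_iff not_le)
  then have "(x b - y b) \<bullet> (x b - y b) = 0"
    using inner_ge_zero[of "x b - y b"] by linarith
  then show ?thesis by simp
qed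

section \<open>Velocities, tangent vectors and geodesics\<close>

lemma norm_fst_snd_le: "norm (fst x) \<le> norm x" "norm (snd x) \<le> norm x"
  by (cases x; simp add: norm_fst_le norm_snd_le)+

lemma velocity_eqI: "(c has_vector_derivative v) (at s) \<Longrightarrow> velocity c s = v"
  unfolding velocity_def by (rule vector_derivative_at)

text \<open>The definition of a geodesic iterates the choice operator behind \<open>velocity\<close>; this rule accepts
explicit first and second derivatives instead.\<close>
lemma geodesic_onI:
  assumes J: "open J" and M: "\<And>s. s \<in> J \<Longrightarrow> c s \<in> M"
    and c1: "\<And>s. s \<in> J \<Longrightarrow> (c has_vector_derivative c1 s) (at s)"
    and c2: "\<And>s. s \<in> J \<Longrightarrow> (c1 has_vector_derivative c2 s) (at s)"
    and normal: "\<And>s w. s \<in> J \<Longrightarrow> w \<in> tangent_vectors M (c s) \<Longrightarrow> c2 s \<bullet> w = 0"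
    and cont: "continuous_on J c2"
  shows "geodesic_on M J c"
proof -
  have v1: "velocity c s = c1 s" if "s \<in> J" for s
    using velocity_eqI[OF c1[OF that]] .
  have d2: "(velocity c has_vector_derivative c2 s) (at s)" if "s \<in> J" for s
    by (rule has_vector_derivative_transform_within_open[OF c2[OF that] J that]) (simp add: v1)
  have v2: "velocity (velocity c) s = c2 s" if "s \<in> J" for s
    using velocity_eqI[OF d2[OF that]] .
  have "continuous_on J (velocity (velocity c))"
    using cont v2 by (simp cong: continuous_on_cong)
  with M c1 d2 v2 normal show ?thesis
    unfolding geodesic_on_def by (auto intro: differentiableI_vector)
qed

lemma geodesic_onD:
  assumes "geodesic_on M J c" "s \<in> J"
  shows "c s \<in> M" "(c has_vector_derivative velocity c s) (at s)"
    "(velocity c has_vector_derivative velocity (velocity c) s) (at s)"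
    "\<And>w. w \<in> tangent_vectors M (c s) \<Longrightarrow> velocity (velocity c) s \<bullet> w = 0"
  using assms unfolding geodesic_on_def by (auto simp: velocity_def vector_derivative_works)

lemma geodesic_on_continuous_acceleration:
  "geodesic_on M J c \<Longrightarrow> continuous_on J (velocity (velocity c))"
  by (simp add: geodesic_on_def)

lemma geodesic_on_subset: "geodesic_on M J c \<Longrightarrow> J' \<subseteq> J \<Longrightarrow> geodesic_on M J' c"
  unfolding geodesic_on_def by (auto intro: continuous_on_subset)

lemma geodesic_on_cong:
  assumes "open J" "geodesic_on M J c" "\<And>s. s \<in> J \<Longrightarrow> d s = c s"
  shows "geodesic_on M J d"
proof (rule geodesic_onI[OF assms(1), where ?c1.0 = "velocity c" and ?c2.0 = "velocity (velocity c)"])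
  fix s assume s: "s \<in> J"
  show "(d has_vector_derivative velocity c s) (at s)"
    by (rule has_vector_derivative_transform_within_open[OF geodesic_onD(2)[OF assms(2) s] assms(1) s])
      (simp add: assms(3))
qed (use assms geodesic_onD[OF assms(2)] geodesic_on_continuous_acceleration in auto)

lemma geodesic_on_UN:
  assumes "\<And>J. J \<in> \<J> \<Longrightarrow> open J" "\<And>J. J \<in> \<J> \<Longrightarrow> geodesic_on M J c"
  shows "geodesic_on M (\<Union>\<J>) c"
proof -
  have "continuous_on (\<Union>\<J>) (velocity (velocity c))"
    using continuous_on_open_Union[of \<J>] assms geodesic_on_continuous_acceleration by blast
  with assms show ?thesis unfolding geodesic_on_def by blast
qed

text \<open>Tangent vectors are velocities at parameter \<open>0\<close>; curves through the point at any parameter serve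
as well, after a shift.\<close>
lemma tangent_vectorsI:
  assumes d: "(c has_vector_derivative v) (at s)" and ev: "eventually (\<lambda>t. c t \<in> M) (nhds s)"
  shows "v \<in> tangent_vectors M (c s)"
proof -
  obtain e where e: "e > 0" "\<And>t. dist t s < e \<Longrightarrow> c t \<in> M"
    using ev unfolding eventually_nhds_metric by blast
  have "((\<lambda>t. c (s + t)) has_vector_derivative v) (at 0)"
  proof -
    have "((\<lambda>t. s + t) has_vector_derivative 1) (at (0::real))"
      by (auto intro!: derivative_eq_intros)
    from vector_diff_chain_at[OF this, of c v] show ?thesis using d unfolding o_def by simp
  qed
  with e show ?thesis
    unfolding tangent_vectors_def
    by (auto simp: dist_real_def intro!: exI[of _ "\<lambda>t. c (s + t)"] exI[of _ e])
qed

lemma tangent_vectorsI_open: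
  assumes "(c has_vector_derivative v) (at s)" "open J" "s \<in> J" "\<And>t. t \<in> J \<Longrightarrow> c t \<in> M"
  shows "v \<in> tangent_vectors M (c s)"
  using assms by (intro tangent_vectorsI) (auto simp: eventually_nhds)

lemma tangent_vectorsE:
  assumes "v \<in> tangent_vectors M p"
  obtains c where "c 0 = p" "(c has_vector_derivative v) (at 0)" "eventually (\<lambda>t. c t \<in> M) (nhds (0::real))"
proof -
  obtain c e where c: "e > 0" "c 0 = p" "\<forall>t\<in>{-e<..<e}. c t \<in> M" "(c has_vector_derivative v) (at 0)"
    using assms unfolding tangent_vectors_def by blast
  have "eventually (\<lambda>t. t \<in> {-e<..<e}) (nhds 0)"
    using c(1) by (intro eventually_nhds_in_open) auto
  then have "eventually (\<lambda>t. c t \<in> M) (nhds 0)"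
    by (rule eventually_mono) (use c(3) in auto)
  then show thesis using c(2,4) by (intro that[of c])
qed

lemma geodesic_on_velocity_tangent:
  assumes "geodesic_on M J c" "open J" "s \<in> J"
  shows "velocity c s \<in> tangent_vectors M (c s)"
  by (rule tangent_vectorsI_open[OF geodesic_onD(2)[OF assms(1,3)] assms(2,3)])
    (rule geodesic_onD(1)[OF assms(1)])

text \<open>The velocity is tangent and the acceleration is normal, so the squared speed has derivative \<open>0\<close>.\<close>
lemma geodesic_on_constant_speed:
  assumes geo: "geodesic_on M J c" and J: "open J" "convex J" and st: "s \<in> J" "t \<in> J"
  shows "norm (velocity c s) = norm (velocity c t)"
proof -
  have "((\<lambda>t. velocity c t \<bullet> velocity c t) has_derivative (\<lambda>h. 0)) (at t within J)" if t: "t \<in> J" for t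
  proof -
    have "velocity (velocity c) t \<bullet> velocity c t = 0"
      using geodesic_onD(4)[OF geo t] geodesic_on_velocity_tangent[OF geo J(1) t] by blast
    then have "((\<lambda>t. velocity c t \<bullet> velocity c t) has_derivative (\<lambda>h. 0)) (at t)"
      using geodesic_onD(3)[OF geo t] unfolding has_vector_derivative_def
      by (auto intro!: derivative_eq_intros simp: inner_commute)
    then show ?thesis by (rule has_derivative_at_withinI)
  qed
  then obtain k where "\<And>t. t \<in> J \<Longrightarrow> velocity c t \<bullet> velocity c t = k"
    using has_derivative_zero_constant[OF J(2), of "\<lambda>t. velocity c t \<bullet> velocity c t"] by blast
  then have "velocity c s \<bullet> velocity c s = velocity c t \<bullet> velocity c t"
    using st by simp
  then show ?thesis by (simp add: norm_eq)
qed

lemma unit_speed_geodesic_dist: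
  assumes geo: "geodesic_on M J c" and unit: "unit_speed_on J c" and J: "convex J" "s \<in> J" "t \<in> J"
  shows "dist (c s) (c t) \<le> dist s t"
proof -
  have "norm (c s - c t) \<le> 1 * norm (s - t)"
  proof (rule differentiable_bound[OF J(1) _ _ J(2,3), where f' = "\<lambda>x h. h *\<^sub>R velocity c x"])
    fix x assume x: "x \<in> J"
    show "(c has_derivative (\<lambda>h. h *\<^sub>R velocity c x)) (at x within J)"
      using geodesic_onD(2)[OF geo x] by (simp add: has_vector_derivative_def has_derivative_at_withinI)
    show "onorm (\<lambda>h. h *\<^sub>R velocity c x) \<le> 1"
      using unit x by (intro onorm_le) (simp add: unit_speed_on_def)
  qed
  then show ?thesis by (simp add: dist_norm)
qed

lemma has_vector_derivative_compose:
  assumes c: "(c has_vector_derivative v) (at s)" and f: "(f has_derivative f') (at (c s))"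
  shows "((\<lambda>t. f (c t)) has_vector_derivative f' v) (at s)"
proof -
  have "bounded_linear f'" using f has_derivative_bounded_linear by blast
  then have "(\<lambda>h. f' (h *\<^sub>R v)) = (\<lambda>h. h *\<^sub>R f' v)"
    by (simp add: linear_cmul bounded_linear.linear)
  then show ?thesis
    using has_derivative_compose[OF c[unfolded has_vector_derivative_def] f]
    by (simp add: has_vector_derivative_def)
qed

lemma has_vector_derivative_cong_nhds:
  assumes "(f has_vector_derivative v) (at s)" "eventually (\<lambda>t. f t = g t) (nhds s)"
  shows "(g has_vector_derivative v) (at s)"
proof -
  obtain W where "open W" "s \<in> W" "\<And>t. t \<in> W \<Longrightarrow> f t = g t"
    using assms(2) unfolding eventually_nhds by blast
  then show ?thesis using has_vector_derivative_transform_within_open[OF assms(1)] by blast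
qed

lemma has_vector_derivative_eventually_in_open:
  assumes "(c has_vector_derivative v) (at s)" "open U" "c s \<in> U"
  shows "eventually (\<lambda>t. c t \<in> U) (nhds s)"
proof -
  have "(c \<longlongrightarrow> c s) (nhds s)"
    using has_vector_derivative_continuous[OF assms(1)] by (simp add: continuous_at tendsto_at_iff_tendsto_nhds)
  then show ?thesis using assms(2,3) topological_tendstoD by blast
qed

text \<open>A subspace of a Euclidean space is the orthogonal complement of its orthogonal complement.  This
is how curves in a subspace are seen to have their velocities in it, and conversely: it reduces both
statements to real functions \<open>t \<mapsto> x t \<bullet> n\<close> that are locally constant.\<close>
lemma mem_subspace_if_orthogonal:
  fixes S :: "'a::euclidean_space set"
  assumes S: "subspace S" and orth: "\<And>n. (\<And>z. z \<in> S \<Longrightarrow> n \<bullet> z = 0) \<Longrightarrow> v \<bullet> n = 0"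
  shows "v \<in> S"
proof -
  obtain y z where yz: "y \<in> span S" "\<And>w. w \<in> span S \<Longrightarrow> orthogonal z w" "v = y + z"
    using orthogonal_subspace_decomp_exists by metis
  have "z \<bullet> w = 0" if "w \<in> S" for w
    using yz(2)[OF span_base[OF that]] by (simp add: orthogonal_def)
  then have "v \<bullet> z = 0" by (rule orth)
  moreover have "y \<bullet> z = 0" using yz(1,2) by (auto simp: orthogonal_def inner_commute)
  ultimately have "z = 0" using yz(3) by (simp add: inner_add_left)
  then show ?thesis using yz S by (metis add.right_neutral span_eq_iff)
qed

lemma has_vector_derivative_in_subspace:
  fixes S :: "'a::euclidean_space set"
  assumes S: "subspace S" and d: "(x has_vector_derivative v) (at s)"
    and ev: "eventually (\<lambda>t. x t \<in> S) (nhds s)"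
  shows "v \<in> S"
proof (rule mem_subspace_if_orthogonal[OF S])
  fix n assume n: "\<And>z. z \<in> S \<Longrightarrow> n \<bullet> z = 0"
  have "((\<lambda>t. x t \<bullet> n) has_vector_derivative v \<bullet> n) (at s)"
    by (rule has_vector_derivative_compose[OF d]) (auto intro!: derivative_eq_intros)
  moreover have "((\<lambda>t. x t \<bullet> n) has_vector_derivative 0) (at s)"
  proof (rule has_vector_derivative_cong_nhds[of "\<lambda>t. 0"])
    show "eventually (\<lambda>t. 0 = x t \<bullet> n) (nhds s)"
      by (rule eventually_mono[OF ev]) (metis n inner_commute)
  qed simp
  ultimately show "v \<bullet> n = 0" using vector_derivative_unique_at by blast
qed

lemma derivative_in_subspace_stays:
  fixes X :: "real \<Rightarrow> 'b::euclidean_space"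
  assumes H: "subspace H" and X: "\<And>t. t \<in> {0..T} \<Longrightarrow> (X has_vector_derivative X' t) (at t within {0..T})"
    and H0: "X 0 \<in> H" and H': "\<And>t. t \<in> {0..T} \<Longrightarrow> X' t \<in> H" and t: "t \<in> {0..T}"
  shows "X t \<in> H"
proof (rule mem_subspace_if_orthogonal[OF H])
  fix n assume n: "\<And>z. z \<in> H \<Longrightarrow> n \<bullet> z = 0"
  have "((\<lambda>t. X t \<bullet> n) has_derivative (\<lambda>h. 0)) (at t within {0..T})" if t: "t \<in> {0..T}" for t
  proof -
    have "X' t \<bullet> n = 0" using n[OF H'[OF t]] by (simp add: inner_commute)
    then show ?thesis
      using X[OF t] unfolding has_vector_derivative_def by (auto intro!: derivative_eq_intros)
  qed
  then obtain k where "\<And>t. t \<in> {0..T} \<Longrightarrow> X t \<bullet> n = k"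
    using has_derivative_zero_constant[of "{0..T}" "\<lambda>t. X t \<bullet> n"] by auto
  moreover have "0 \<in> {0..T}" using t by auto
  ultimately show "X t \<bullet> n = 0" using n[OF H0] t by (simp add: inner_commute)
qed

text \<open>The value of the second derivative at \<open>x\<close> on the pair \<open>(v, v)\<close>.  One of the two arguments is
expanded in a basis because \<open>Ck_on\<close> gives control of derivatives in fixed directions only.\<close>
definition second_derivative ::
  "('a::euclidean_space \<Rightarrow> 'b::real_normed_vector) \<Rightarrow> 'a \<Rightarrow> 'a \<Rightarrow> 'b" where
  "second_derivative f x v =
     (\<Sum>b\<in>Basis. (v \<bullet> b) *\<^sub>R frechet_derivative (\<lambda>x. frechet_derivative f (at x) b) (at x) v)"

lemma has_vector_derivative_derivative_along:
  fixes f :: "'a::euclidean_space \<Rightarrow> 'b::real_normed_vector"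
  assumes f: "Ck_on (Suc (Suc k)) f U" and U: "open U" "c s \<in> U"
    and c: "(c has_vector_derivative w s) (at s)" and w: "(w has_vector_derivative w') (at s)"
  shows "((\<lambda>t. frechet_derivative f (at (c t)) (w t)) has_vector_derivative
     frechet_derivative f (at (c s)) w' + second_derivative f (c s) (w s)) (at s)"
proof -
  let ?D = "\<lambda>x. frechet_derivative f (at x)"
  have exp: "?D x v = (\<Sum>b\<in>Basis. (v \<bullet> b) *\<^sub>R ?D x b)" if "x \<in> U" for x v
    by (rule linear_basis_expansion[OF has_derivative_bounded_linear[OF Ck_on_has_derivative[OF f that]]])
  have "((\<lambda>t. \<Sum>b\<in>Basis. (w t \<bullet> b) *\<^sub>R ?D (c t) b) has_vector_derivative
     (\<Sum>b\<in>Basis. (w s \<bullet> b) *\<^sub>R frechet_derivative (\<lambda>x. ?D x b) (at (c s)) (w s) + (w' \<bullet> b) *\<^sub>R ?D (c s) b)) (at s)"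
  proof (rule has_vector_derivative_sum, rule has_vector_derivative_scaleR)
    fix b :: 'a
    show "((\<lambda>t. w t \<bullet> b) has_field_derivative w' \<bullet> b) (at s)"
      unfolding has_real_derivative_iff_has_vector_derivative
      by (rule has_vector_derivative_compose[OF w]) (auto intro!: derivative_eq_intros)
    show "((\<lambda>t. ?D (c t) b) has_vector_derivative frechet_derivative (\<lambda>x. ?D x b) (at (c s)) (w s)) (at s)"
      by (rule has_vector_derivative_compose[OF c Ck_on_has_derivative[OF Ck_on_frechet[OF f] U(2)]])
  qed
  also have "(\<Sum>b\<in>Basis. (w s \<bullet> b) *\<^sub>R frechet_derivative (\<lambda>x. ?D x b) (at (c s)) (w s) + (w' \<bullet> b) *\<^sub>R ?D (c s) b)
      = ?D (c s) w' + second_derivative f (c s) (w s)"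
    using exp[OF U(2), of w'] by (simp add: second_derivative_def sum.distrib)
  finally show ?thesis
    by (rule has_vector_derivative_cong_nhds)
      (use has_vector_derivative_eventually_in_open[OF c U] exp in \<open>auto elim!: eventually_mono\<close>)
qed

text \<open>Continuity and Lipschitz estimates for the geodesic equation are needed jointly in the point and
the direction, so the derivative is regarded as a function on the product.\<close>
lemma Ck_on_derivative_uncurried:
  fixes f :: "'a::euclidean_space \<Rightarrow> 'b::real_normed_vector"
  assumes f: "Ck_on (Suc k) f U" and U: "open U"
  shows "Ck_on k (\<lambda>x. frechet_derivative f (at (fst x)) (snd x)) (U \<times> UNIV)"
proof (rule Ck_on_cong)
  show op: "open (U \<times> (UNIV :: 'a set))" using U by (simp add: open_Times)
  show "Ck_on k (\<lambda>x. \<Sum>b\<in>Basis. (snd x \<bullet> b) *\<^sub>R frechet_derivative f (at (fst x)) b) (U \<times> (UNIV :: 'a set))"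
  proof (rule Ck_on_sum[OF op finite_Basis], rule Ck_on_bilinear[OF bounded_bilinear_scaleR op])
    fix b :: 'a
    show "Ck_on k (\<lambda>x. snd x \<bullet> b) (U \<times> (UNIV :: 'a set))"
      by (rule Ck_on_bounded_linear[OF op])
        (rule bounded_linear_compose[OF bounded_linear_inner_left bounded_linear_snd])
    show "Ck_on k (\<lambda>x. frechet_derivative f (at (fst x)) b) (U \<times> (UNIV :: 'a set))"
      by (rule Ck_on_compose[OF op U _ Ck_on_frechet[OF f] Ck_on_bounded_linear[OF op bounded_linear_fst]]) auto
  qed
  show "(\<Sum>b\<in>Basis. (snd x \<bullet> b) *\<^sub>R frechet_derivative f (at (fst x)) b) = frechet_derivative f (at (fst x)) (snd x)"
    if "x \<in> U \<times> UNIV" for x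
  proof -
    have "fst x \<in> U" using that by auto
    from linear_basis_expansion[OF has_derivative_bounded_linear[OF Ck_on_has_derivative[OF f this]]]
    show ?thesis by (rule sym)
  qed
qed

lemma Ck_on_second_derivative_uncurried:
  fixes f :: "'a::euclidean_space \<Rightarrow> 'b::real_normed_vector"
  assumes f: "Ck_on (Suc (Suc k)) f U" and U: "open U"
  shows "Ck_on k (\<lambda>x. second_derivative f (fst x) (snd x)) (U \<times> UNIV)"
proof -
  have op: "open (U \<times> (UNIV :: 'a set))" using U by (simp add: open_Times)
  show ?thesis
    unfolding second_derivative_def
  proof (rule Ck_on_sum[OF op finite_Basis], rule Ck_on_bilinear[OF bounded_bilinear_scaleR op])
    fix b :: 'a
    show "Ck_on k (\<lambda>x. snd x \<bullet> b) (U \<times> (UNIV :: 'a set))"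
      by (rule Ck_on_bounded_linear[OF op])
        (rule bounded_linear_compose[OF bounded_linear_inner_left bounded_linear_snd])
  qed (rule Ck_on_derivative_uncurried[OF Ck_on_frechet[OF f] U])
qed

section \<open>The geodesic equation in a chart\<close>

text \<open>The orthogonality condition determines \<open>h\<close> from the map \<open>L\<close> and the vector \<open>a\<close>.  The estimate says that
\<open>h\<close> depends on both in a Lipschitz way when \<open>L\<close> is bounded below.  Testing both conditions with the
difference \<open>z\<close> of the solutions bounds \<open>\<parallel>L z\<parallel>\<^sup>2\<close> by terms linear in \<open>\<parallel>L z\<parallel>\<close>; no inverse of the Gram
matrix \<open>L\<^sup>T L\<close> has to be formed.\<close>
lemma orthogonality_solution_stable:
  fixes L L' :: "'a::real_inner \<Rightarrow> 'b::real_inner"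
  assumes lin: "linear L" "linear L'" and S: "subspace S" "h \<in> S" "h' \<in> S"
    and h: "\<And>z. z \<in> S \<Longrightarrow> (L h + a) \<bullet> L z = 0"
    and h': "\<And>z. z \<in> S \<Longrightarrow> (L' h' + a') \<bullet> L' z = 0"
    and below: "\<And>z. norm z \<le> m * norm (L z)" "\<And>z. norm z \<le> m * norm (L' z)"
    and m: "m \<ge> 0" and e: "e \<ge> 0" "\<And>z. norm (L z - L' z) \<le> e * norm z"
    and a: "norm a' \<le> k" "norm (a - a') \<le> d"
  shows "norm (h - h') \<le> m * (d + 3 * m * k * e)"
proof -
  define z where "z = h - h'"
  have zS: "z \<in> S" using S by (simp add: z_def subspace_diff)
  have Lz: "L z = L h - L h'" using lin by (simp add: z_def linear_diff)
  have k: "k \<ge> 0" using a(1) norm_ge_zero order_trans by blast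
  \<comment> \<open>\<open>L' h'\<close> is minus the orthogonal projection of \<open>a'\<close>, hence not longer than \<open>a'\<close>.\<close>
  have Lh': "norm (L' h') \<le> k"
  proof -
    have "norm (L' h') * norm (L' h') = - (a' \<bullet> L' h')"
      using h'[OF S(3)] by (simp add: inner_add_left power2_norm_eq_inner[symmetric] power2_eq_square)
    also have "\<dots> \<le> norm a' * norm (L' h')"
      using norm_cauchy_schwarz[of "- a'" "L' h'"] by simp
    also have "\<dots> \<le> k * norm (L' h')" using a(1) by (intro mult_right_mono) auto
    finally show ?thesis by (cases "L' h' = 0") (use k in auto)
  qed
  have nh': "norm h' \<le> m * k"
    using below(2)[of h'] Lh' mult_left_mono[OF Lh' m] by linarith
  have "norm (L z) * norm (L z) = - ((a - a') \<bullet> L z) - (L h' - L' h') \<bullet> L z - (a' + L' h') \<bullet> (L z - L' z)"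
  proof -
    have "(L h - L h') \<bullet> L z = - (a \<bullet> L z) - L h' \<bullet> L z"
      using h[OF zS] by (simp add: inner_add_left inner_diff_left)
    moreover have "(L' h' + a') \<bullet> L' z = 0" by (rule h'[OF zS])
    ultimately show ?thesis
      unfolding Lz[symmetric] by (simp add: inner_add_left inner_diff_left inner_diff_right
          power2_norm_eq_inner[symmetric] power2_eq_square)
  qed
  also have "\<dots> \<le> d * norm (L z) + (e * (m * k)) * norm (L z) + (2 * k) * (e * norm z)"
  proof -
    have "- ((a - a') \<bullet> L z) \<le> d * norm (L z)"
      using Cauchy_Schwarz_ineq2[of "a - a'" "L z"] mult_right_mono[OF a(2) norm_ge_zero, of "L z"]
      by linarith
    moreover have "- ((L h' - L' h') \<bullet> L z) \<le> (e * (m * k)) * norm (L z)"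
    proof -
      have "norm (L h' - L' h') \<le> e * (m * k)"
        using e(2)[of h'] mult_left_mono[OF nh' e(1)] by linarith
      from mult_right_mono[OF this norm_ge_zero, of "L z"] show ?thesis
        using Cauchy_Schwarz_ineq2[of "L h' - L' h'" "L z"] by linarith
    qed
    moreover have "- ((a' + L' h') \<bullet> (L z - L' z)) \<le> (2 * k) * (e * norm z)"
    proof -
      have "- ((a' + L' h') \<bullet> (L z - L' z)) \<le> norm (a' + L' h') * norm (L z - L' z)"
        using Cauchy_Schwarz_ineq2[of "a' + L' h'" "L z - L' z"] by linarith
      also have "\<dots> \<le> (2 * k) * (e * norm z)"
        using norm_triangle_ineq[of a' "L' h'"] a(1) Lh' e k by (intro mult_mono) auto
      finally show ?thesis .
    qed
    ultimately show ?thesis by linarith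
  qed
  also have "\<dots> \<le> d * norm (L z) + (e * (m * k)) * norm (L z) + (2 * k) * (e * (m * norm (L z)))"
    using below(1)[of z] e(1) k by (intro add_left_mono mult_left_mono) auto
  also have "\<dots> = (d + 3 * m * k * e) * norm (L z)" by (simp add: algebra_simps)
  finally have *: "norm (L z) * norm (L z) \<le> (d + 3 * m * k * e) * norm (L z)" .
  have "d \<ge> 0" using a(2) norm_ge_zero order_trans by blast
  then have "norm (L z) \<le> d + 3 * m * k * e"
    using * k e m by (cases "L z = 0") auto
  from order_trans[OF below(1)[of z] mult_left_mono[OF this m]] show ?thesis
    by (simp add: z_def)
qed

text \<open>A flattening chart \<open>f\<close> with inverse \<open>g\<close>, as in the definition of a submanifold; only the restriction
of \<open>g\<close> to \<open>S\<close> matters for \<open>M\<close>, and it is a parametrization of the part of \<open>M\<close> in \<open>U\<close>.\<close>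
locale submanifold_chart =
  fixes M U V S :: "'a::euclidean_space set" and f g :: "'a \<Rightarrow> 'a"
  assumes open_U: "open U" and open_V: "open V" and f_image: "f ` U = V"
    and g_f: "x \<in> U \<Longrightarrow> g (f x) = x"
    and f_C3: "Ck_on 3 f U" and g_C3: "Ck_on 3 g V"
    and subspace_S: "subspace S" and f_M: "f ` (M \<inter> U) = S \<inter> V"
begin

abbreviation "Df x \<equiv> frechet_derivative f (at x)"
abbreviation "Dg y \<equiv> frechet_derivative g (at y)"

lemma f_C: "Ck_on (Suc (Suc (Suc 0))) f U" and g_C: "Ck_on (Suc (Suc (Suc 0))) g V"
  using f_C3 g_C3 by (simp_all add: eval_nat_numeral)

lemma g_V: assumes "y \<in> V" shows "g y \<in> U" "f (g y) = y"
  using assms f_image g_f by auto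

lemma g_M:
  assumes "y \<in> S" "y \<in> V"
  shows "g y \<in> M"
proof -
  have "y \<in> f ` (M \<inter> U)" using assms f_M by simp
  then show ?thesis using g_f by auto
qed

lemma f_S: "x \<in> M \<Longrightarrow> x \<in> U \<Longrightarrow> f x \<in> S" and f_V: "x \<in> U \<Longrightarrow> f x \<in> V"
  using f_M f_image by auto

lemma Df: "x \<in> U \<Longrightarrow> (f has_derivative Df x) (at x)"
  and Dg: "y \<in> V \<Longrightarrow> (g has_derivative Dg y) (at y)"
  using Ck_on_has_derivative[OF f_C] Ck_on_has_derivative[OF g_C] by auto

lemma linear_Dg: "y \<in> V \<Longrightarrow> linear (Dg y)"
  using Dg has_derivative_bounded_linear bounded_linear.linear by blast

lemma Df_Dg:
  assumes "y \<in> V" shows "Df (g y) (Dg y z) = z"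
proof -
  have "((\<lambda>y. f (g y)) has_derivative (\<lambda>z. Df (g y) (Dg y z))) (at y)"
    using has_derivative_compose[OF Dg[OF assms] Df[OF g_V(1)[OF assms]]] .
  moreover have "((\<lambda>y. f (g y)) has_derivative (\<lambda>z. z)) (at y)"
    by (rule has_derivative_transform_within_open[OF has_derivative_ident open_V assms]) (simp add: g_V)
  ultimately show ?thesis using has_derivative_unique by metis
qed

lemma chart_curve:
  assumes c: "(c has_vector_derivative v) (at s)" and cM: "eventually (\<lambda>t. c t \<in> M) (nhds s)" and U: "c s \<in> U"
  shows "((\<lambda>t. f (c t)) has_vector_derivative Df (c s) v) (at s)" "Df (c s) v \<in> S"
    "v = Dg (f (c s)) (Df (c s) v)"
proof -
  have evU: "eventually (\<lambda>t. c t \<in> U) (nhds s)"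
    by (rule has_vector_derivative_eventually_in_open[OF c open_U U])
  show fc: "((\<lambda>t. f (c t)) has_vector_derivative Df (c s) v) (at s)"
    by (rule has_vector_derivative_compose[OF c Df[OF U]])
  show "Df (c s) v \<in> S"
    by (rule has_vector_derivative_in_subspace[OF subspace_S fc])
      (use cM evU in eventually_elim, rule f_S)
  have "((\<lambda>t. g (f (c t))) has_vector_derivative Dg (f (c s)) (Df (c s) v)) (at s)"
    by (rule has_vector_derivative_compose[OF fc Dg[OF f_V[OF U]]])
  then have "(c has_vector_derivative Dg (f (c s)) (Df (c s) v)) (at s)"
    by (rule has_vector_derivative_cong_nhds) (use evU g_f in \<open>auto elim: eventually_mono\<close>)
  then show "v = Dg (f (c s)) (Df (c s) v)"
    using c vector_derivative_unique_at by blast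
qed

text \<open>Velocities of curves in \<open>M\<close> correspond under \<open>f\<close> to velocities of curves in the subspace \<open>S\<close>, and
every vector of \<open>S\<close> is realized by a straight line.\<close>
lemma tangent_vectors_chart:
  assumes "y \<in> S" "y \<in> V"
  shows "tangent_vectors M (g y) = Dg y ` S"
proof (intro equalityI subsetI)
  fix v assume "v \<in> tangent_vectors M (g y)"
  then obtain c where c: "c 0 = g y" "(c has_vector_derivative v) (at 0)" "eventually (\<lambda>t. c t \<in> M) (nhds (0::real))"
    by (rule tangent_vectorsE)
  show "v \<in> Dg y ` S"
    using chart_curve[OF c(2,3)] g_V[OF assms(2)] by (auto simp: c(1))
next
  fix v assume "v \<in> Dg y ` S"
  then obtain z where z: "z \<in> S" "v = Dg y z" by auto
  have line: "((\<lambda>t. y + t *\<^sub>R z) has_vector_derivative z) (at 0)"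
    by (auto intro!: derivative_eq_intros)
  have "eventually (\<lambda>t. y + t *\<^sub>R z \<in> V) (nhds 0)"
    by (rule has_vector_derivative_eventually_in_open[OF line open_V]) (use assms in simp)
  then have "eventually (\<lambda>t. g (y + t *\<^sub>R z) \<in> M) (nhds 0)"
    by (rule eventually_mono) (use assms z subspace_S in \<open>auto intro!: g_M subspace_add subspace_scale\<close>)
  moreover have "((\<lambda>t. g (y + t *\<^sub>R z)) has_vector_derivative v) (at 0)"
    unfolding z(2) by (rule has_vector_derivative_compose[OF line]) (use Dg assms in simp)
  ultimately show "v \<in> tangent_vectors M (g y)"
    using tangent_vectorsI[of "\<lambda>t. g (y + t *\<^sub>R z)" v 0] by simp
qed

text \<open>The coordinate acceleration of the geodesic with position \<open>y\<close> and velocity \<open>w\<close>, that is, the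
Christoffel symbols applied to \<open>(w, w)\<close> with a minus sign.  It is specified by the orthogonality that
defines geodesics rather than by the inverse metric.\<close>
definition accel :: "'a \<Rightarrow> 'a \<Rightarrow> 'a" where
  "accel y w = (SOME h. h \<in> S \<and> (\<forall>z\<in>S. (Dg y h + second_derivative g y w) \<bullet> Dg y z = 0))"

lemma accel:
  assumes y: "y \<in> V"
  shows "accel y w \<in> S" "\<And>z. z \<in> S \<Longrightarrow> (Dg y (accel y w) + second_derivative g y w) \<bullet> Dg y z = 0"
proof -
  let ?a = "second_derivative g y w"
  have sub: "subspace (Dg y ` S)"
    using linear_Dg[OF y] subspace_S by (rule linear_subspace_image)
  obtain p n where p: "p \<in> span (Dg y ` S)" "\<And>w. w \<in> span (Dg y ` S) \<Longrightarrow> orthogonal n w" "?a = p + n"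
    using orthogonal_subspace_decomp_exists by metis
  obtain k where k: "k \<in> S" "p = Dg y k" using p(1) sub by (auto simp: span_eq_iff[THEN iffD2])
  \<comment> \<open>Subtracting from the second derivative its projection \<open>p\<close> onto the tangent space leaves the
  normal part \<open>n\<close>.\<close>
  have "Dg y (- k) + ?a = n" using p(3) k(2) linear_neg[OF linear_Dg[OF y]] by simp
  moreover have "n \<bullet> Dg y z = 0" if "z \<in> S" for z
    using p(2)[of "Dg y z"] that by (auto simp: orthogonal_def intro: span_base)
  ultimately have "- k \<in> S \<and> (\<forall>z\<in>S. (Dg y (- k) + ?a) \<bullet> Dg y z = 0)"
    using k(1) subspace_S by (simp add: subspace_neg)
  then have "accel y w \<in> S \<and> (\<forall>z\<in>S. (Dg y (accel y w) + ?a) \<bullet> Dg y z = 0)"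
    unfolding accel_def by (rule someI)
  then show "accel y w \<in> S" "\<And>z. z \<in> S \<Longrightarrow> (Dg y (accel y w) + ?a) \<bullet> Dg y z = 0" by auto
qed

lemma accel_unique:
  assumes y: "y \<in> V" and h: "h \<in> S" "\<And>z. z \<in> S \<Longrightarrow> (Dg y h + second_derivative g y w) \<bullet> Dg y z = 0"
  shows "h = accel y w"
proof -
  let ?z = "h - accel y w"
  have z: "?z \<in> S" using h(1) accel(1)[OF y] subspace_S by (simp add: subspace_diff)
  have "Dg y ?z \<bullet> Dg y ?z = 0"
    using h(2)[OF z] accel(2)[OF y z, of w]
    unfolding inner_add_left linear_diff[OF linear_Dg[OF y], of h "accel y w"] inner_diff_left
    by linarith
  then have "Dg y ?z = Dg y 0" using linear_0[OF linear_Dg[OF y]] by simp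
  then show ?thesis using Df_Dg[OF y] by (metis eq_iff_diff_eq_0)
qed

text \<open>Coordinates \<open>u\<close>, \<open>w\<close> of position and velocity solve the first order system.  The coordinate velocity \<open>w\<close>
is differentiable since \<open>f\<close> is twice differentiable; its derivative must be \<open>accel\<close> because \<open>c = g \<circ> u\<close> has
normal acceleration and \<open>accel\<close> is the only solution of that condition.\<close>
lemma geodesic_on_chart_equation:
  assumes geo: "geodesic_on M J c" and J: "open J" "s \<in> J" and U: "c s \<in> U"
  defines "u \<equiv> \<lambda>t. f (c t)" and "w \<equiv> \<lambda>t. Df (c t) (velocity c t)"
  shows "u s \<in> S \<inter> V" "w s \<in> S" "c s = g (u s)"
    "(u has_vector_derivative w s) (at s)" "(w has_vector_derivative accel (u s) (w s)) (at s)"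
proof -
  have evJ: "eventually (\<lambda>t. t \<in> J) (nhds s)" using J by (rule eventually_nhds_in_open)
  have "eventually (\<lambda>t. c t \<in> U) (nhds s)"
    by (rule has_vector_derivative_eventually_in_open[OF geodesic_onD(2)[OF geo J(2)] open_U U])
  with evJ have ev: "eventually (\<lambda>t. t \<in> J \<and> c t \<in> U) (nhds s)" by eventually_elim simp
  have chart: "(u has_vector_derivative w t) (at t) \<and> w t \<in> S \<and> velocity c t = Dg (u t) (w t)"
    if "t \<in> J" "c t \<in> U" for t
  proof -
    have "eventually (\<lambda>t. t \<in> J) (nhds t)" using J(1) that(1) by (rule eventually_nhds_in_open)
    then have "eventually (\<lambda>t. c t \<in> M) (nhds t)" by (rule eventually_mono) (rule geodesic_onD(1)[OF geo])
    from chart_curve[OF geodesic_onD(2)[OF geo that(1)] this that(2)] show ?thesis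
      unfolding u_def w_def by blast
  qed
  show us: "u s \<in> S \<inter> V" using f_S[OF geodesic_onD(1)[OF geo J(2)] U] f_V[OF U] by (simp add: u_def)
  show "c s = g (u s)" using g_f[OF U] by (simp add: u_def)
  show ws: "w s \<in> S" and u: "(u has_vector_derivative w s) (at s)" using chart[OF J(2) U] by auto
  define w' where "w' = Df (c s) (velocity (velocity c) s) + second_derivative f (c s) (velocity c s)"
  have w: "(w has_vector_derivative w') (at s)"
    unfolding w_def w'_def
    by (rule has_vector_derivative_derivative_along[OF f_C open_U U geodesic_onD(2,3)[OF geo J(2)]])
  have w'S: "w' \<in> S"
    by (rule has_vector_derivative_in_subspace[OF subspace_S w])
      (rule eventually_mono[OF ev], use chart in blast)
  have "((\<lambda>t. Dg (u t) (w t)) has_vector_derivative Dg (u s) w' + second_derivative g (u s) (w s)) (at s)"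
    by (rule has_vector_derivative_derivative_along[OF g_C open_V _ u w]) (use us in simp)
  then have "(velocity c has_vector_derivative Dg (u s) w' + second_derivative g (u s) (w s)) (at s)"
    by (rule has_vector_derivative_cong_nhds) (rule eventually_mono[OF ev], use chart in metis)
  then have acc: "velocity (velocity c) s = Dg (u s) w' + second_derivative g (u s) (w s)"
    by (rule velocity_eqI)
  have "w' = accel (u s) (w s)"
  proof (rule accel_unique[OF _ w'S])
    fix z assume z: "z \<in> S"
    have "Dg (u s) z \<in> tangent_vectors M (c s)"
      using tangent_vectors_chart[of "u s"] us z \<open>c s = g (u s)\<close> by auto
    from geodesic_onD(4)[OF geo J(2) this]
    show "(Dg (u s) w' + second_derivative g (u s) (w s)) \<bullet> Dg (u s) z = 0" by (simp only: acc)
  qed (use us in simp)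
  with w show "(w has_vector_derivative accel (u s) (w s)) (at s)" by simp
qed

text \<open>By the choice of \<open>accel\<close> the second derivative of \<open>g \<circ> u\<close> is orthogonal to \<open>Dg (u s) ` S\<close>, which is the whole
tangent space of \<open>M\<close>.\<close>
lemma geodesic_on_of_chart_equation:
  assumes J: "open J" and uS: "\<And>s. s \<in> J \<Longrightarrow> u s \<in> S" and uV: "\<And>s. s \<in> J \<Longrightarrow> u s \<in> V"
    and u: "\<And>s. s \<in> J \<Longrightarrow> (u has_vector_derivative w s) (at s)"
    and w: "\<And>s. s \<in> J \<Longrightarrow> (w has_vector_derivative accel (u s) (w s)) (at s)"
    and cont: "continuous_on J (\<lambda>s. accel (u s) (w s))"
  shows "geodesic_on M J (\<lambda>s. g (u s))"
proof (rule geodesic_onI[OF J, where ?c1.0 = "\<lambda>s. Dg (u s) (w s)" and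
      ?c2.0 = "\<lambda>s. Dg (u s) (accel (u s) (w s)) + second_derivative g (u s) (w s)"])
  fix s assume s: "s \<in> J"
  show "g (u s) \<in> M" using s uS uV by (intro g_M)
  show "((\<lambda>s. g (u s)) has_vector_derivative Dg (u s) (w s)) (at s)"
    by (rule has_vector_derivative_compose[OF u[OF s] Dg[OF uV[OF s]]])
  show "((\<lambda>s. Dg (u s) (w s)) has_vector_derivative Dg (u s) (accel (u s) (w s)) + second_derivative g (u s) (w s)) (at s)"
    by (rule has_vector_derivative_derivative_along[OF g_C open_V uV[OF s] u[OF s] w[OF s]])
  fix v assume "v \<in> tangent_vectors M (g (u s))"
  then show "(Dg (u s) (accel (u s) (w s)) + second_derivative g (u s) (w s)) \<bullet> v = 0"
    using tangent_vectors_chart[OF uS[OF s] uV[OF s]] accel(2)[OF uV[OF s]] by auto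
next
  have cu: "continuous_on J u" and cw: "continuous_on J w"
    using u w has_vector_derivative_continuous by (blast intro: continuous_at_imp_continuous_on)+
  have 1: "continuous_on J (\<lambda>s. Dg (fst (u s, accel (u s) (w s))) (snd (u s, accel (u s) (w s))))"
    by (rule continuous_on_compose2[OF Ck_on_continuous[OF Ck_on_derivative_uncurried[OF g_C open_V]]])
      (use uV in \<open>auto intro!: continuous_on_Pair cu cont\<close>)
  have 2: "continuous_on J (\<lambda>s. second_derivative g (fst (u s, w s)) (snd (u s, w s)))"
    by (rule continuous_on_compose2[OF Ck_on_continuous[OF Ck_on_second_derivative_uncurried[OF g_C open_V]]])
      (use uV in \<open>auto intro!: continuous_on_Pair cu cw\<close>)
  show "continuous_on J (\<lambda>s. Dg (u s) (accel (u s) (w s)) + second_derivative g (u s) (w s))"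
    using continuous_on_add[OF 1 2] by simp
qed

text \<open>The stability estimate applies uniformly over a compact convex set: \<open>Dg\<close> is bounded below there
because \<open>Df\<close> is a bounded left inverse of it, and \<open>Dg\<close> and the second derivative are Lipschitz because
\<open>g\<close> is \<open>C\<^sup>3\<close>.\<close>
lemma accel_lipschitz:
  assumes Y: "compact Y" "convex Y" "Y \<subseteq> V" and W: "compact W" "convex W"
  obtains C where "C \<ge> 0" "\<And>x x'. x \<in> Y \<times> W \<Longrightarrow> x' \<in> Y \<times> W \<Longrightarrow>
    norm (accel (fst x) (snd x) - accel (fst x') (snd x')) \<le> C * norm (x - x')"
proof -
  have gY: "compact (g ` Y)" "g ` Y \<subseteq> U"
    using Y g_V continuous_on_subset[OF Ck_on_continuous[OF g_C]] compact_continuous_image by blast+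
  obtain m where m: "m > 0" "\<And>x v. x \<in> g ` Y \<Longrightarrow> norm (Df x v) \<le> m * norm v"
    using Ck_on_derivative_bounded_on_compact[OF f_C gY] by blast
  have below: "norm z \<le> m * norm (Dg y z)" if "y \<in> Y" for y z
    using m(2)[of "g y" "Dg y z"] Df_Dg[of y z] that Y by auto
  have "\<exists>C>0. \<forall>y\<in>Y. \<forall>y'\<in>Y. norm (Dg y b - Dg y' b) \<le> C * norm (y - y')" for b
    using Ck_on_lipschitz_on_compact_convex[OF Ck_on_frechet[OF g_C] Y(1,3,2), of b] by metis
  then obtain E where E: "\<And>b. E b > 0"
    "\<And>b y y'. y \<in> Y \<Longrightarrow> y' \<in> Y \<Longrightarrow> norm (Dg y b - Dg y' b) \<le> E b * norm (y - y')" by metis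
  define e where "e = (\<Sum>b\<in>Basis. E b)"
  have e0: "e \<ge> 0" unfolding e_def by (intro sum_nonneg) (use E(1) in \<open>auto intro: less_imp_le\<close>)
  have e: "norm (Dg y z - Dg y' z) \<le> (e * norm (y - y')) * norm z" if "y \<in> Y" "y' \<in> Y" for y y' z
  proof -
    have "y \<in> V" "y' \<in> V" using that Y by auto
    then have bl: "bounded_linear (Dg y)" "bounded_linear (Dg y')" using Dg has_derivative_bounded_linear by blast+
    have "Dg y z - Dg y' z = (\<Sum>b\<in>Basis. (z \<bullet> b) *\<^sub>R (Dg y b - Dg y' b))"
      unfolding linear_basis_expansion[OF bl(1), of z] linear_basis_expansion[OF bl(2), of z]
      by (simp add: sum_subtractf scaleR_diff_right)
    also have "norm \<dots> \<le> (\<Sum>b\<in>Basis. norm z * (E b * norm (y - y')))"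
      by (rule sum_norm_le) (use that E in \<open>auto intro!: mult_mono Basis_le_norm\<close>)
    finally show ?thesis by (simp add: e_def sum_distrib_left sum_distrib_right ac_simps)
  qed
  have YW: "compact (Y \<times> W)" "Y \<times> W \<subseteq> V \<times> UNIV" "convex (Y \<times> W)"
    using Y W by (auto intro: compact_Times convex_Times)
  note a_C1 = Ck_on_second_derivative_uncurried[OF g_C open_V]
  obtain k where k: "k > 0" "\<And>x. x \<in> Y \<times> W \<Longrightarrow> norm (second_derivative g (fst x) (snd x)) \<le> k"
    using Ck_on_bounded_on_compact[OF a_C1 YW(1,2)] by blast
  obtain d where d: "d > 0" "\<And>x x'. x \<in> Y \<times> W \<Longrightarrow> x' \<in> Y \<times> W \<Longrightarrow>
      norm (second_derivative g (fst x) (snd x) - second_derivative g (fst x') (snd x')) \<le> d * norm (x - x')"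
    using Ck_on_lipschitz_on_compact_convex[OF a_C1 YW] by blast
  show thesis
  proof (rule that[of "m * (d + 3 * m * k * e)"])
    show "0 \<le> m * (d + 3 * m * k * e)" using m(1) d(1) k(1) e0 by simp
    fix x x' assume x: "x \<in> Y \<times> W" "x' \<in> Y \<times> W"
    then have Y': "fst x \<in> Y" "fst x' \<in> Y" and V': "fst x \<in> V" "fst x' \<in> V" using Y(3) by auto
    have "norm (accel (fst x) (snd x) - accel (fst x') (snd x'))
        \<le> m * (d * norm (x - x') + 3 * m * k * (e * norm (x - x')))"
    proof (rule orthogonality_solution_stable[OF linear_Dg[OF V'(1)] linear_Dg[OF V'(2)] subspace_S
          accel(1)[OF V'(1)] accel(1)[OF V'(2)] accel(2)[OF V'(1)] accel(2)[OF V'(2)]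
          below[OF Y'(1)] below[OF Y'(2)] less_imp_le[OF m(1)] _ _ k(2)[OF x(2)] d(2)[OF x]])
      have "norm (fst x - fst x') \<le> norm (x - x')" using norm_fst_snd_le(1)[of "x - x'"] by simp
      then have "e * norm (fst x - fst x') \<le> e * norm (x - x')" by (rule mult_left_mono[OF _ e0])
      then show "norm (Dg (fst x) z - Dg (fst x') z) \<le> (e * norm (x - x')) * norm z" for z
        using e[OF Y', of z] mult_right_mono[OF _ norm_ge_zero[of z]] by (meson order_trans)
    qed (use e0 in auto)
    then show "norm (accel (fst x) (snd x) - accel (fst x') (snd x')) \<le> m * (d + 3 * m * k * e) * norm (x - x')"
      by (simp add: algebra_simps)
  qed
qed

text \<open>Near \<open>p\<close> the coordinate system is solved from the state of \<open>c\<close> at \<open>s0\<close>, for a time \<open>T\<close> that depends on \<open>p\<close>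
only, and uniqueness identifies the solution with \<open>c\<close> as long as \<open>c\<close> is defined.  To have a globally
Lipschitz right-hand side, the field is precomposed with the nearest point map of a compact convex
set \<open>K\<close> of positions and velocities; \<open>T\<close> is so small that neither the solution nor \<open>c\<close> can
leave \<open>K\<close>, where both fields agree.  Since \<open>K\<close> consists of pairs of vectors of \<open>S\<close>, the modified field
has values in \<open>S \<times> S\<close> and the solution cannot leave the subspace either.\<close>
lemma geodesic_local_continuation:
  assumes p: "p \<in> M" "p \<in> U"
  obtains r T where "r > 0" "T > 0"
    "\<And>c a b s0. \<lbrakk>geodesic_on M {a<..<b} c; unit_speed_on {a<..<b} c; s0 \<in> {a<..<b}; c s0 \<in> ball p r\<rbrakk> \<Longrightarrow>
       \<exists>\<phi>. geodesic_on M {s0<..<s0 + T} \<phi> \<and> (\<forall>t. s0 < t \<and> t < s0 + T \<and> t < b \<longrightarrow> \<phi> t = c t)"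
proof -
  let ?y = "f p"
  have y: "?y \<in> S" "?y \<in> V" using p f_S f_V by auto
  obtain \<rho> where \<rho>: "\<rho> > 0" "cball ?y \<rho> \<subseteq> V" using open_V y(2) open_contains_cball by blast
  have "continuous_on U f" using Ck_on_continuous[OF f_C3] .
  then have "open (f -` ball ?y (\<rho> / 2) \<inter> U)" using open_U by (simp add: continuous_on_open_vimage)
  moreover have "p \<in> f -` ball ?y (\<rho> / 2) \<inter> U" using \<rho>(1) p by simp
  ultimately obtain r where r: "r > 0" "cball p r \<subseteq> f -` ball ?y (\<rho> / 2) \<inter> U"
    unfolding open_contains_cball by blast
  obtain R where R: "R > 0" "\<And>x v. x \<in> cball p r \<Longrightarrow> norm (Df x v) \<le> R * norm v"
    using Ck_on_derivative_bounded_on_compact[OF f_C compact_cball[of p r]] r(2) by blast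
  define Y where "Y = S \<inter> cball ?y \<rho>"
  define W where "W = S \<inter> cball 0 (R + 1)"
  define K where "K = Y \<times> W"
  have S: "closed S" "convex S" using subspace_S closed_subspace subspace_imp_convex by blast+
  have conv: "compact Y" "convex Y" "compact W" "convex W"
    using S by (auto simp: Y_def W_def intro!: closed_Int_compact convex_Int)
  have YV: "Y \<subseteq> V" using \<rho> by (auto simp: Y_def)
  have K: "compact K" "convex K" "closed K" "K \<noteq> {}"
  proof -
    show "compact K" "convex K" using conv by (auto simp: K_def intro: compact_Times convex_Times)
    then show "closed K" using compact_imp_closed by blast
    have "(?y, 0) \<in> K" using y \<rho>(1) R(1) subspace_0[OF subspace_S] by (simp add: K_def Y_def W_def)
    then show "K \<noteq> {}" by auto
  qed
  define F where "F x = (snd x, accel (fst x) (snd x))" for x :: "'a \<times> 'a"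
  define G where "G x = F (closest_point K x)" for x
  obtain C where C: "C \<ge> 0" "\<And>x x'. x \<in> K \<Longrightarrow> x' \<in> K \<Longrightarrow>
      norm (accel (fst x) (snd x) - accel (fst x') (snd x')) \<le> C * norm (x - x')"
    using accel_lipschitz[OF conv(1,2) YV conv(3,4)] unfolding K_def by metis
  have F_lip: "norm (F x - F x') \<le> (C + 1) * norm (x - x')" if "x \<in> K" "x' \<in> K" for x x'
  proof -
    have "norm (F x - F x') \<le> norm (snd x - snd x') + norm (accel (fst x) (snd x) - accel (fst x') (snd x'))"
      unfolding F_def using norm_Pair_le by (simp add: norm_Pair_le)
    also have "norm (snd x - snd x') \<le> norm (x - x')"
      using norm_fst_snd_le(2)[of "x - x'"] by simp
    finally show ?thesis using C(2)[OF that] by (simp add: algebra_simps)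
  qed
  have in_K: "closest_point K x \<in> K" for x using closest_point_in_set[OF K(3,4)] .
  have G_lip: "norm (G x - G x') \<le> (C + 1) * norm (x - x')" for x x'
  proof -
    have "norm (G x - G x') \<le> (C + 1) * norm (closest_point K x - closest_point K x')"
      unfolding G_def by (rule F_lip[OF in_K in_K])
    also have "\<dots> \<le> (C + 1) * norm (x - x')"
      using closest_point_lipschitz[OF K(2,3,4), of x x'] C(1) by (intro mult_left_mono) (auto simp: dist_norm)
    finally show ?thesis .
  qed
  have G_cont: "continuous_on UNIV G"
    using G_lip C(1) by (intro lipschitz_on_continuous_on[of "C + 1"] lipschitz_onI) (auto simp: dist_norm)
  obtain B where B: "B > 0" "\<And>x. norm (G x) \<le> B"
  proof -
    have "continuous_on K F"
      using F_lip C(1) by (intro lipschitz_on_continuous_on[of "C + 1"] lipschitz_onI) (auto simp: dist_norm)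
    then have "bounded (F ` K)" using K(1) compact_continuous_image compact_imp_bounded by blast
    then show thesis using that in_K unfolding bounded_pos G_def by blast
  qed
  \<comment> \<open>The four bounds serve, in this order: the contraction estimate, positions staying within \<open>\<rho>\<close>,
  coordinate velocities growing by at most \<open>1\<close>, and \<open>c\<close> staying in \<open>cball p r\<close>.\<close>
  define T where "T = Min {1 / (2 * (C + 1)), \<rho> / (2 * B), 1 / B, r / 2}"
  have "T \<le> 1 / (2 * (C + 1))" "T \<le> \<rho> / (2 * B)" "T \<le> 1 / B" and Tr: "T \<le> r / 2"
    unfolding T_def by (intro Min_le; simp)+
  then have TC: "T * (C + 1) \<le> 1 / 2" and TB: "T * B \<le> \<rho> / 2" "T * B \<le> 1"
    using C(1) B(1) by (simp_all add: field_simps)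
  have T: "T > 0" using C(1) B(1) \<rho>(1) r(1) by (simp add: T_def)
  show thesis
  proof (rule that[of "r / 2" T])
    show "r / 2 > 0" "T > 0" using r T by auto
    fix c a b s0
    assume geo: "geodesic_on M {a<..<b} c" and unit: "unit_speed_on {a<..<b} c"
      and s0: "s0 \<in> {a<..<b}" and near: "c s0 \<in> ball p (r / 2)"
    have c_near: "c t \<in> cball p r" if t: "s0 \<le> t" "t < b" "t < s0 + T" for t
    proof -
      have "dist (c s0) (c t) \<le> dist s0 t"
        by (rule unit_speed_geodesic_dist[OF geo unit]) (use s0 t in auto)
      also have "\<dots> \<le> r / 2" using t Tr by (simp add: dist_real_def)
      finally show ?thesis using near dist_triangle[of p "c t" "c s0"] by simp
    qed
    define u where "u t = f (c t)" for t
    define w where "w t = Df (c t) (velocity c t)" for t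
    have eqn: "u t \<in> S" "w t \<in> S" "c t = g (u t)" "(u has_vector_derivative w t) (at t)"
        "(w has_vector_derivative accel (u t) (w t)) (at t)" "u t \<in> ball ?y (\<rho> / 2)" "norm (w t) \<le> R"
      if t: "s0 \<le> t" "t < b" "t < s0 + T" for t
    proof -
      have J: "t \<in> {a<..<b}" using t s0 by auto
      have cU: "c t \<in> U" and cb: "f (c t) \<in> ball ?y (\<rho> / 2)" using c_near[OF t] r(2) by auto
      from geodesic_on_chart_equation[OF geo open_greaterThanLessThan J cU]
      show "u t \<in> S" "w t \<in> S" "c t = g (u t)" "(u has_vector_derivative w t) (at t)"
        "(w has_vector_derivative accel (u t) (w t)) (at t)"
        by (simp_all add: u_def[abs_def] w_def[abs_def])
      show "u t \<in> ball ?y (\<rho> / 2)" using cb by (simp add: u_def)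
      show "norm (w t) \<le> R"
        using R(2)[OF c_near[OF t], of "velocity c t"] unit J by (simp add: w_def unit_speed_on_def)
    qed
    have uw_K: "(u t, w t) \<in> K" if t: "s0 \<le> t" "t < b" "t < s0 + T" for t
      using eqn[OF t] \<rho>(1) by (auto simp: K_def Y_def W_def)
    obtain X where X: "X 0 = (u s0, w s0)"
      "\<And>t. t \<in> {0..T} \<Longrightarrow> (X has_vector_derivative G (X t)) (at t within {0..T})"
      using picard_lindeloef_lipschitz[of G "C + 1" T "(u s0, w s0)"] G_lip T TC by blast
    have s0': "s0 \<le> s0" "s0 < b" "s0 < s0 + T" using s0 T by auto
    have X_SS: "X t \<in> S \<times> S" if "t \<in> {0..T}" for t
    proof (rule derivative_in_subspace_stays[OF _ X(2) _ _ that])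
      show "subspace (S \<times> S)" by (rule subspace_Times[OF subspace_S subspace_S])
      show "X 0 \<in> S \<times> S" using eqn[OF s0'] X(1) by simp
      show "G (X t) \<in> S \<times> S" for t
        using in_K[of "X t"] YV accel(1) by (auto simp: G_def F_def K_def W_def)
    qed
    have X_close: "norm (X t - X 0) \<le> B * T" if t: "t \<in> {0..T}" for t
    proof -
      have "norm (X t - X 0) \<le> B * norm (t - 0)"
      proof (rule differentiable_bound[of "{0..T}" X "\<lambda>t h. h *\<^sub>R G (X t)"])
        show "onorm (\<lambda>h. h *\<^sub>R G (X t)) \<le> B" for t
          by (intro onorm_le) (use B(2) in \<open>simp add: mult.commute[of B] mult_left_mono\<close>)
      qed (use X(2) t T in \<open>auto simp: has_vector_derivative_def\<close>)
      also have "\<dots> \<le> B * T" using t B(1) by auto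
      finally show ?thesis .
    qed
    have X_K: "X t \<in> K" if t: "t \<in> {0..T}" for t
    proof -
      have *: "norm (fst (X t) - u s0) \<le> \<rho> / 2" "norm (snd (X t) - w s0) \<le> 1"
        using X_close[OF t] TB norm_fst_snd_le[of "X t - X 0"] X(1)
        by (auto simp: mult.commute)
      have "dist ?y (fst (X t)) \<le> \<rho>"
        using *(1) eqn(6)[OF s0'] dist_triangle[of ?y "fst (X t)" "u s0"] by (simp add: dist_norm norm_minus_commute)
      moreover have "norm (snd (X t)) \<le> R + 1"
        using *(2) eqn(7)[OF s0'] norm_triangle_sub[of "snd (X t)" "w s0"] by simp
      ultimately show ?thesis
        using X_SS[OF t] by (cases "X t") (auto simp: K_def Y_def W_def)
    qed
    have G_F: "G x = F x" if "x \<in> K" for x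
      using closest_point_self[OF that] by (simp add: G_def)
    have X_at: "((\<lambda>t. X (t - s0)) has_vector_derivative F (X (t - s0))) (at t)"
      if t: "s0 < t" "t < s0 + T" for t
    proof -
      have t': "t - s0 \<in> {0<..<T}" "t - s0 \<in> {0..T}" using t by auto
      have "(X has_vector_derivative G (X (t - s0))) (at (t - s0))"
        using has_vector_derivative_within_subset[OF X(2)[OF t'(2)], of "{0<..<T}"]
          at_within_open[OF t'(1)] by (simp add: greaterThanLessThan_subseteq_atLeastAtMost_iff)
      moreover have "((\<lambda>t. t - s0) has_vector_derivative 1) (at t)"
        by (auto intro!: derivative_eq_intros)
      ultimately show ?thesis
        using vector_diff_chain_at[of "\<lambda>t. t - s0" 1 t X] G_F[OF X_K[OF t'(2)]] by (simp add: o_def)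
    qed
    define \<phi> where "\<phi> t = g (fst (X (t - s0)))" for t
    have X_cont: "continuous_on {s0..s0 + T} (\<lambda>t. X (t - s0))"
    proof (rule continuous_on_compose2[of "{0..T}" X])
      show "continuous_on {0..T} X"
        using X(2) has_vector_derivative_continuous continuous_on_eq_continuous_within by blast
    qed (auto intro!: continuous_intros)
    have "geodesic_on M {s0<..<s0 + T} \<phi>"
      unfolding \<phi>_def
    proof (rule geodesic_on_of_chart_equation[where w = "\<lambda>t. snd (X (t - s0))"])
      show "open {s0<..<s0 + T}" by simp
      fix t assume "t \<in> {s0<..<s0 + T}"
      then have t: "s0 < t" "t < s0 + T" "t - s0 \<in> {0..T}" by auto
      show "fst (X (t - s0)) \<in> S" using X_SS[OF t(3)] by auto
      show "fst (X (t - s0)) \<in> V" using X_K[OF t(3)] YV by (auto simp: K_def)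
      show "((\<lambda>t. fst (X (t - s0))) has_vector_derivative snd (X (t - s0))) (at t)"
        using has_vector_derivative_compose[OF X_at[OF t(1,2)], of fst fst]
        by (simp add: F_def bounded_linear_imp_has_derivative bounded_linear_fst)
      show "((\<lambda>t. snd (X (t - s0))) has_vector_derivative accel (fst (X (t - s0))) (snd (X (t - s0)))) (at t)"
        using has_vector_derivative_compose[OF X_at[OF t(1,2)], of snd snd]
        by (simp add: F_def bounded_linear_imp_has_derivative bounded_linear_snd)
    next
      have "continuous_on {s0<..<s0 + T} (\<lambda>t. snd (G (X (t - s0))))"
        by (intro continuous_on_snd continuous_on_compose2[OF G_cont] continuous_on_subset[OF X_cont]) auto
      moreover have "snd (G (X (t - s0))) = accel (fst (X (t - s0))) (snd (X (t - s0)))"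
        if "t \<in> {s0<..<s0 + T}" for t
        using G_F[OF X_K[of "t - s0"]] that by (simp add: F_def)
      ultimately show "continuous_on {s0<..<s0 + T} (\<lambda>t. accel (fst (X (t - s0))) (snd (X (t - s0))))"
        by (rule continuous_on_eq)
    qed
    moreover have "\<phi> t = c t" if t: "s0 < t" "t < s0 + T" "t < b" for t
    proof -
      have uw_at: "((\<lambda>t. (u t, w t)) has_vector_derivative F (u s, w s)) (at s)" if "s0 \<le> s" "s \<le> t" for s
        using eqn(4,5)[of s] that t by (simp add: F_def has_vector_derivative_Pair)
      have "X (t - s0) = (u t, w t)"
      proof (rule lipschitz_ode_unique[of G "C + 1" s0 t "\<lambda>t. X (t - s0)" "\<lambda>t. (u t, w t)", OF G_lip])
        show "continuous_on {s0..t} (\<lambda>t. X (t - s0))" by (rule continuous_on_subset[OF X_cont]) (use t in auto)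
        show "continuous_on {s0..t} (\<lambda>t. (u t, w t))"
          by (intro continuous_at_imp_continuous_on ballI has_vector_derivative_continuous[OF uw_at]) auto
        fix s assume s: "s0 < s" "s < t"
        have "s - s0 \<in> {0..T}" using s t by auto
        then show "((\<lambda>t. X (t - s0)) has_vector_derivative G (X (s - s0))) (at s)"
          using X_at[of s] s t G_F X_K by simp
        show "((\<lambda>t. (u t, w t)) has_vector_derivative G (u s, w s)) (at s)"
          using uw_at[of s] s t G_F uw_K by simp
      qed (use X(1) t in auto)
      then show ?thesis using eqn(3)[of t] t by (simp add: \<phi>_def)
    qed
    ultimately show "\<exists>\<phi>. geodesic_on M {s0<..<s0 + T} \<phi> \<and> (\<forall>t. s0 < t \<and> t < s0 + T \<and> t < b \<longrightarrow> \<phi> t = c t)"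
      by blast
  qed
qed

end

section \<open>Geodesic completeness of closed submanifolds\<close>

text \<open>Compactness of \<open>M\<close> turns the local durations into a common one.\<close>
lemma geodesic_uniform_continuation:
  assumes "closed_Ck_submanifold 3 n (M :: 'a::euclidean_space set)"
  obtains T where "T > 0"
    "\<And>c a b s0. \<lbrakk>geodesic_on M {a<..<b} c; unit_speed_on {a<..<b} c; s0 \<in> {a<..<b}\<rbrakk> \<Longrightarrow>
       \<exists>\<phi>. geodesic_on M {s0<..<s0 + T} \<phi> \<and> (\<forall>t. s0 < t \<and> t < s0 + T \<and> t < b \<longrightarrow> \<phi> t = c t)"
proof -
  define good where "good p r T \<longleftrightarrow> r > 0 \<and> T > 0 \<and> (\<forall>c a b s0. geodesic_on M {a<..<b} c \<longrightarrow>
      unit_speed_on {a<..<b} c \<longrightarrow> s0 \<in> {a<..<b} \<longrightarrow> c s0 \<in> ball p r \<longrightarrow>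
       (\<exists>\<phi>. geodesic_on M {s0<..<s0 + T} \<phi> \<and> (\<forall>t. s0 < t \<and> t < s0 + T \<and> t < b \<longrightarrow> \<phi> t = c t)))"
    for p r T
  have "\<exists>r T. good p r T" if p: "p \<in> M" for p
  proof -
    obtain U V S and f g :: "'a \<Rightarrow> 'a" where *: "open U" "p \<in> U" "open V" "f ` U = V" "\<forall>x\<in>U. g (f x) = x"
        "Ck_on 3 f U" "Ck_on 3 g V" "subspace S" "f ` (M \<inter> U) = S \<inter> V"
      using assms p unfolding closed_Ck_submanifold_def Ck_submanifold_def by blast
    then interpret submanifold_chart M U V S f g by unfold_locales auto
    show ?thesis
      using geodesic_local_continuation[OF p *(2)] unfolding good_def by metis
  qed
  then obtain r \<tau> where rt: "\<And>p. p \<in> M \<Longrightarrow> good p (r p) (\<tau> p)" by metis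
  have "compact M" using assms by (simp add: closed_Ck_submanifold_def)
  moreover have "M \<subseteq> (\<Union>p\<in>M. ball p (r p))" using rt by (auto simp: good_def)
  ultimately obtain D where D: "D \<subseteq> M" "finite D" "M \<subseteq> (\<Union>p\<in>D. ball p (r p))"
    using compactE_image[of M M "\<lambda>p. ball p (r p)"] by auto
  define T where "T = Min (insert 1 (\<tau> ` D))"
  show thesis
  proof (rule that[of T])
    show "T > 0" using D rt by (auto simp: T_def good_def)
    fix c a b s0
    assume c: "geodesic_on M {a<..<b} c" "unit_speed_on {a<..<b} c" "s0 \<in> {a<..<b}"
    have "c s0 \<in> M" by (rule geodesic_onD(1)[OF c(1,3)])
    then obtain p where p: "p \<in> D" "c s0 \<in> ball p (r p)" using D(3) by blast
    have "good p (r p) (\<tau> p)" using rt p D by blast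
    then obtain \<phi> where \<phi>: "geodesic_on M {s0<..<s0 + \<tau> p} \<phi>"
      "\<forall>t. s0 < t \<and> t < s0 + \<tau> p \<and> t < b \<longrightarrow> \<phi> t = c t"
      using c p(2) unfolding good_def by blast
    have "T \<le> \<tau> p" unfolding T_def using D(2) p by (intro Min_le) auto
    then have "geodesic_on M {s0<..<s0 + T} \<phi>" "\<forall>t. s0 < t \<and> t < s0 + T \<and> t < b \<longrightarrow> \<phi> t = c t"
      using \<phi> by (auto intro: geodesic_on_subset)
    then show "\<exists>\<phi>. geodesic_on M {s0<..<s0 + T} \<phi> \<and> (\<forall>t. s0 < t \<and> t < s0 + T \<and> t < b \<longrightarrow> \<phi> t = c t)"
      by blast
  qed
qed

text \<open>The continuation is started at most \<open>T / 2\<close> before the end of the interval, so it reaches at least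
\<open>T / 2\<close> beyond; the two curves are glued along an open overlap, where they agree.  This avoids
any discussion of limits at the end of the interval.\<close>
lemma geodesic_on_extend_right:
  assumes c: "geodesic_on M {a<..<b} c" "unit_speed_on {a<..<b} c" "a < b" and T: "T > 0"
    and cont: "\<And>s0. s0 \<in> {a<..<b} \<Longrightarrow>
      \<exists>\<phi>. geodesic_on M {s0<..<s0 + T} \<phi> \<and> (\<forall>t. s0 < t \<and> t < s0 + T \<and> t < b \<longrightarrow> \<phi> t = c t)"
  obtains d where "geodesic_on M {a<..<b + T / 2} d" "unit_speed_on {a<..<b + T / 2} d"
    "\<And>t. t < b \<Longrightarrow> d t = c t"
proof -
  \<comment> \<open>The midpoint enters only to keep \<open>s0\<close> inside a short interval.\<close>
  define s0 where "s0 = max ((a + b) / 2) (b - T / 2)"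
  have s0: "s0 \<in> {a<..<b}" "b + T / 2 \<le> s0 + T" using c(3) T by (auto simp: s0_def max_def field_simps)
  obtain \<phi> where \<phi>: "geodesic_on M {s0<..<s0 + T} \<phi>"
    "\<And>t. s0 < t \<Longrightarrow> t < s0 + T \<Longrightarrow> t < b \<Longrightarrow> \<phi> t = c t" using cont[OF s0(1)] by blast
  define d where "d t = (if t < b then c t else \<phi> t)" for t
  have d1: "geodesic_on M {a<..<b} d"
    by (rule geodesic_on_cong[OF _ c(1)]) (auto simp: d_def)
  have d2: "geodesic_on M {s0<..<s0 + T} d"
    by (rule geodesic_on_cong[OF _ \<phi>(1)]) (auto simp: d_def \<phi>(2))
  have "geodesic_on M (\<Union>{{a<..<b}, {s0<..<s0 + T}}) d"
    by (rule geodesic_on_UN) (use d1 d2 in auto)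
  then have d: "geodesic_on M {a<..<b + T / 2} d"
    by (rule geodesic_on_subset) (use s0 in auto)
  have "velocity d s0 = velocity c s0"
    by (rule velocity_eqI, rule has_vector_derivative_transform_within_open[OF geodesic_onD(2)[OF c(1) s0(1)]
        open_greaterThanLessThan s0(1)]) (simp add: d_def)
  then have "norm (velocity d s0) = 1" using c(2) s0(1) by (simp add: unit_speed_on_def)
  then have "norm (velocity d t) = 1" if "t \<in> {a<..<b + T / 2}" for t
    using geodesic_on_constant_speed[OF d _ _ that, of s0] s0 T by simp
  then have "unit_speed_on {a<..<b + T / 2} d" by (simp add: unit_speed_on_def)
  with d show thesis by (rule that) (simp add: d_def)
qed

lemma geodesic_on_reflect:
  assumes "geodesic_on M {a<..<b} c"
  shows "geodesic_on M {-b<..<-a} (\<lambda>s. c (- s))"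
    and "unit_speed_on {a<..<b} c \<Longrightarrow> unit_speed_on {-b<..<-a} (\<lambda>s. c (- s))"
proof -
  have neg: "((\<lambda>s. x (- s)) has_vector_derivative - v) (at s)"
    if "(x has_vector_derivative v) (at (- s))" for x :: "real \<Rightarrow> 'a" and v s
  proof -
    have "((\<lambda>s. - s) has_vector_derivative - 1) (at s)" by (auto intro!: derivative_eq_intros)
    from vector_diff_chain_at[OF this, of x v] that show ?thesis by (simp add: o_def)
  qed
  have J: "- s \<in> {a<..<b}" if "s \<in> {-b<..<-a}" for s using that by auto
  have vel: "((\<lambda>s. c (- s)) has_vector_derivative - velocity c (- s)) (at s)" if "s \<in> {-b<..<-a}" for s
    by (rule neg[OF geodesic_onD(2)[OF assms J[OF that]]])
  show "geodesic_on M {-b<..<-a} (\<lambda>s. c (- s))"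
  proof (rule geodesic_onI[where ?c1.0 = "\<lambda>s. - velocity c (- s)" and ?c2.0 = "\<lambda>s. velocity (velocity c) (- s)"])
    fix s assume s: "s \<in> {-b<..<-a}"
    show "((\<lambda>s. c (- s)) has_vector_derivative - velocity c (- s)) (at s)" by (rule vel[OF s])
    show "((\<lambda>s. - velocity c (- s)) has_vector_derivative velocity (velocity c) (- s)) (at s)"
      using has_vector_derivative_minus[OF neg[OF geodesic_onD(3)[OF assms J[OF s]]]] by simp
    show "velocity (velocity c) (- s) \<bullet> w = 0" if "w \<in> tangent_vectors M (c (- s))" for w
      by (rule geodesic_onD(4)[OF assms J[OF s] that])
  next
    show "continuous_on {-b<..<-a} (\<lambda>s. velocity (velocity c) (- s))"
      by (rule continuous_on_compose2[OF geodesic_on_continuous_acceleration[OF assms]])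
        (auto intro!: continuous_intros)
  qed (use geodesic_onD(1)[OF assms J] in auto)
  show "unit_speed_on {-b<..<-a} (\<lambda>s. c (- s))" if "unit_speed_on {a<..<b} c"
    using that J velocity_eqI[OF vel] by (simp add: unit_speed_on_def)
qed

text \<open>A Hopf-Rinow type statement for closed submanifolds.  Each step prolongs the interval by \<open>T / 2\<close> at
both ends, at the left end by time reversal; the choice of successive prolongations is
compatible, so they have a common extension.\<close>
theorem closed_submanifold_geodesically_complete:
  fixes M :: "'a::euclidean_space set"
  assumes M: "closed_Ck_submanifold 3 n M"
    and c: "geodesic_on M {-R<..<R} c" "unit_speed_on {-R<..<R} c" and R: "R > 0"
  shows "\<exists>\<sigma>. complete_geodesic_extension M {-R<..<R} c \<sigma>"
proof -
  obtain T where T: "T > 0" and cont: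
    "\<And>c a b s0. \<lbrakk>geodesic_on M {a<..<b} c; unit_speed_on {a<..<b} c; s0 \<in> {a<..<b}\<rbrakk> \<Longrightarrow>
       \<exists>\<phi>. geodesic_on M {s0<..<s0 + T} \<phi> \<and> (\<forall>t. s0 < t \<and> t < s0 + T \<and> t < b \<longrightarrow> \<phi> t = c t)"
    using geodesic_uniform_continuation[OF M] by blast
  define \<rho> where "\<rho> k = R + real k * (T / 2)" for k
  define ok where "ok k d \<longleftrightarrow> geodesic_on M {-\<rho> k<..<\<rho> k} d \<and> unit_speed_on {-\<rho> k<..<\<rho> k} d" for k d
  have \<rho>: "\<rho> k > 0" "\<rho> (Suc k) = \<rho> k + T / 2" for k
    using R T by (simp_all add: \<rho>_def add_pos_nonneg algebra_simps)
  have step: "\<exists>e. ok (Suc k) e \<and> (\<forall>t\<in>{-\<rho> k<..<\<rho> k}. e t = d t)" if d: "ok k d" for k d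
  proof -
    have d': "geodesic_on M {-\<rho> k<..<\<rho> k} d" "unit_speed_on {-\<rho> k<..<\<rho> k} d"
      using d by (auto simp: ok_def)
    have "- \<rho> k < \<rho> k" using \<rho>(1)[of k] by linarith
    then obtain d1 where d1: "geodesic_on M {-\<rho> k<..<\<rho> k + T / 2} d1" "unit_speed_on {-\<rho> k<..<\<rho> k + T / 2} d1"
      "\<And>t. t < \<rho> k \<Longrightarrow> d1 t = d t"
      using geodesic_on_extend_right[OF d' _ T cont[OF d']] by blast
    let ?d2 = "\<lambda>s. d1 (- s)"
    have d2: "geodesic_on M {- (\<rho> k + T / 2)<..<\<rho> k} ?d2" "unit_speed_on {- (\<rho> k + T / 2)<..<\<rho> k} ?d2"
      using geodesic_on_reflect[OF d1(1)] d1(2) by auto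
    have "- (\<rho> k + T / 2) < \<rho> k" using \<rho>(1)[of k] T by linarith
    then obtain d3 where d3: "geodesic_on M {- (\<rho> k + T / 2)<..<\<rho> k + T / 2} d3"
      "unit_speed_on {- (\<rho> k + T / 2)<..<\<rho> k + T / 2} d3" "\<And>t. t < \<rho> k \<Longrightarrow> d3 t = ?d2 t"
      using geodesic_on_extend_right[OF d2 _ T] cont[OF d2] by blast
    have "ok (Suc k) (\<lambda>s. d3 (- s))"
      using geodesic_on_reflect[OF d3(1)] d3(2) by (simp add: ok_def \<rho>(2) add.commute)
    moreover have "d3 (- t) = d t" if "t \<in> {-\<rho> k<..<\<rho> k}" for t
      using d1(3)[of t] d3(3)[of "- t"] that by auto
    ultimately show ?thesis by blast
  qed
  have "ok 0 c" using c by (simp add: ok_def \<rho>_def)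
  have "\<exists>d. \<forall>k. (ok k (d k) \<and> (k = 0 \<longrightarrow> d k = c)) \<and> (\<forall>t\<in>{-\<rho> k<..<\<rho> k}. d (Suc k) t = d k t)"
  proof (rule dependent_nat_choice)
    show "\<exists>d. ok 0 d \<and> (0 = (0 :: nat) \<longrightarrow> d = c)" using \<open>ok 0 c\<close> by blast
    show "\<exists>e. (ok (Suc k) e \<and> (Suc k = 0 \<longrightarrow> e = c)) \<and> (\<forall>t\<in>{-\<rho> k<..<\<rho> k}. e t = d t)"
      if "ok k d \<and> (k = 0 \<longrightarrow> d = c)" for d k
      using step[of k d] that by blast
  qed
  then obtain d where d: "d 0 = c" "\<And>k. ok k (d k)" "\<And>k t. t \<in> {-\<rho> k<..<\<rho> k} \<Longrightarrow> d (Suc k) t = d k t"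
    by blast
  have mono: "d (k + j) t = d k t" if "t \<in> {-\<rho> k<..<\<rho> k}" for k j t
  proof (induction j)
    case (Suc j)
    have "\<rho> k \<le> \<rho> (k + j)" using T by (simp add: \<rho>_def)
    then have "t \<in> {-\<rho> (k + j)<..<\<rho> (k + j)}" using that by auto
    from d(3)[OF this] Suc show ?case by simp
  qed simp
  define \<sigma> where "\<sigma> t = d (LEAST k. t \<in> {-\<rho> k<..<\<rho> k}) t" for t
  have \<sigma>: "\<sigma> t = d k t" if "t \<in> {-\<rho> k<..<\<rho> k}" for k t
  proof -
    let ?m = "LEAST k. t \<in> {-\<rho> k<..<\<rho> k}"
    have "t \<in> {-\<rho> ?m<..<\<rho> ?m}" using that by (rule LeastI)
    moreover have "?m \<le> k" using that by (rule Least_le)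
    ultimately show ?thesis using mono[of t ?m "k - ?m"] by (simp add: \<sigma>_def)
  qed
  have geo: "geodesic_on M {-\<rho> k<..<\<rho> k} \<sigma>" for k
    by (rule geodesic_on_cong[of _ _ "d k"]) (use d(2)[of k] \<sigma> in \<open>auto simp: ok_def\<close>)
  have "geodesic_on M (\<Union>(range (\<lambda>k. {-\<rho> k<..<\<rho> k}))) \<sigma>"
    by (rule geodesic_on_UN) (use geo in auto)
  moreover have "(\<Union>(range (\<lambda>k. {-\<rho> k<..<\<rho> k}))) = UNIV"
  proof (rule UNIV_eq_I[symmetric])
    fix t :: real
    obtain k where "\<bar>t\<bar> < real k * (T / 2)" using reals_Archimedean3[of "T / 2"] T by auto
    then have "t \<in> {-\<rho> k<..<\<rho> k}" using R by (auto simp: \<rho>_def)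
    then show "t \<in> (\<Union>(range (\<lambda>k. {-\<rho> k<..<\<rho> k})))" by blast
  qed
  moreover have "\<sigma> t = c t" if "t \<in> {-R<..<R}" for t
    using \<sigma>[of t 0] that d(1) by (simp add: \<rho>_def)
  ultimately show ?thesis unfolding complete_geodesic_extension_def by auto
qed

section \<open>The link of the cone is a closed submanifold\<close>

text \<open>Charts of \<open>M'\<close> are pulled back along local \<open>C\<^sup>k\<close> diffeomorphisms of the ambient space that carry \<open>M\<close> to \<open>M'\<close>.\<close>
lemma Ck_submanifold_local_diffeo:
  fixes M M' :: "'a::euclidean_space set"
  assumes M': "Ck_submanifold k n M'"
    and loc: "\<And>p. p \<in> M \<Longrightarrow> \<exists>A B \<phi> \<psi>. open A \<and> open B \<and> p \<in> A \<and> \<phi> ` A \<subseteq> B \<and> \<psi> ` B \<subseteq> A \<and>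
      (\<forall>x\<in>A. \<psi> (\<phi> x) = x) \<and> (\<forall>y\<in>B. \<phi> (\<psi> y) = y) \<and> Ck_on k \<phi> A \<and> Ck_on k \<psi> B \<and>
      (\<forall>x\<in>A. x \<in> M \<longleftrightarrow> \<phi> x \<in> M')"
  shows "Ck_submanifold k n M"
  unfolding Ck_submanifold_def
proof
  fix p assume p: "p \<in> M"
  obtain A B and \<phi> \<psi> :: "'a \<Rightarrow> 'a" where A: "open A" "open B" "p \<in> A" "\<phi> ` A \<subseteq> B" "\<psi> ` B \<subseteq> A"
      "\<forall>x\<in>A. \<psi> (\<phi> x) = x" "\<forall>y\<in>B. \<phi> (\<psi> y) = y" "Ck_on k \<phi> A" "Ck_on k \<psi> B"
      "\<forall>x\<in>A. x \<in> M \<longleftrightarrow> \<phi> x \<in> M'"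
    using loc[OF p] by (elim exE conjE) (rule that)
  have \<phi>p: "\<phi> p \<in> M'" using A p by blast
  obtain U V S and f g :: "'a \<Rightarrow> 'a" where U: "open U" "\<phi> p \<in> U" "open V" "f ` U = V"
      "\<forall>x\<in>U. g (f x) = x" "Ck_on k f U" "Ck_on k g V" "subspace S" "dim S = n"
      "f ` (M' \<inter> U) = S \<inter> V"
    using bspec[OF M'[unfolded Ck_submanifold_def] \<phi>p] by (elim exE conjE) (rule that)
  define U1 where "U1 = \<phi> -` U \<inter> A"
  define V1 where "V1 = g -` B \<inter> V"
  have U1: "open U1"
    using Ck_on_continuous[OF A(8)] A(1) U(1) by (simp add: U1_def continuous_on_open_vimage)
  have V1: "open V1"
    using Ck_on_continuous[OF U(7)] A(2) U(3) by (simp add: V1_def continuous_on_open_vimage)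
  have img: "y = f (\<phi> (\<psi> (g y)))" "\<psi> (g y) \<in> U1" if "y \<in> V1" for y
    using that A U by (auto simp: U1_def V1_def)
  have "(\<lambda>x. f (\<phi> x)) ` U1 = V1"
  proof (intro equalityI subsetI)
    show "y \<in> V1" if "y \<in> (\<lambda>x. f (\<phi> x)) ` U1" for y using that A U by (auto simp: U1_def V1_def)
    show "y \<in> (\<lambda>x. f (\<phi> x)) ` U1" if "y \<in> V1" for y using img[OF that] by (rule image_eqI)
  qed
  moreover have "(\<lambda>x. f (\<phi> x)) ` (M \<inter> U1) = S \<inter> V1"
  proof (intro equalityI subsetI)
    fix y assume "y \<in> (\<lambda>x. f (\<phi> x)) ` (M \<inter> U1)"
    then obtain x where x: "x \<in> M" "x \<in> A" "\<phi> x \<in> U" "y = f (\<phi> x)" by (auto simp: U1_def)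
    then have "y \<in> f ` (M' \<inter> U)" using A(10) by blast
    then show "y \<in> S \<inter> V1" using U(10) U(5) x(3) A(4) x by (auto simp: V1_def)
  next
    fix y assume y: "y \<in> S \<inter> V1"
    then have "y \<in> f ` (M' \<inter> U)" using U(10) by (auto simp: V1_def)
    then have "g y \<in> M'" using U(5) by auto
    moreover have "g y \<in> B" using y by (simp add: V1_def)
    ultimately have "\<psi> (g y) \<in> M" using A(5,7,10) by force
    then show "y \<in> (\<lambda>x. f (\<phi> x)) ` (M \<inter> U1)" using img[of y] y by (intro image_eqI) auto
  qed
  moreover have "Ck_on k (\<lambda>x. f (\<phi> x)) U1"
    by (rule Ck_on_compose[OF U1 U(1) _ U(6) Ck_on_subset[OF A(8)]]) (auto simp: U1_def)
  moreover have "Ck_on k (\<lambda>y. \<psi> (g y)) V1"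
    by (rule Ck_on_compose[OF V1 A(2) _ A(9) Ck_on_subset[OF U(7)]]) (auto simp: V1_def)
  moreover have "\<forall>x\<in>U1. \<psi> (g (f (\<phi> x))) = x" using A U by (auto simp: U1_def)
  moreover have "p \<in> U1" using A(3) U(2) by (simp add: U1_def)
  ultimately show "\<exists>U V (f :: 'a \<Rightarrow> 'a) g S. open U \<and> p \<in> U \<and> open V \<and> f ` U = V \<and> (\<forall>x\<in>U. g (f x) = x) \<and>
      Ck_on k f U \<and> Ck_on k g V \<and> subspace S \<and> dim S = n \<and> f ` (M \<inter> U) = S \<inter> V"
    using U1 V1 U(8,9)
    by (intro exI[of _ U1] exI[of _ V1] exI[of _ "\<lambda>x. f (\<phi> x)"] exI[of _ "\<lambda>y. \<psi> (g y)"] exI[of _ S] conjI)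
qed

lemma Ck_on_norm:
  fixes U :: "'a::real_inner set"
  assumes "open U" "0 \<notin> U" shows "Ck_on k norm U"
proof -
  have id: "Ck_on k (\<lambda>x. x) U" by (rule Ck_on_bounded_linear[OF assms(1) bounded_linear_ident])
  have "Ck_on k (\<lambda>x. sqrt (x \<bullet> x)) U"
    by (rule Ck_on_compose[OF assms(1) _ _ Ck_on_sqrt Ck_on_bilinear[OF bounded_bilinear_inner assms(1) id id]])
      (use assms in auto)
  then show ?thesis by (simp add: norm_eq_sqrt_inner[abs_def])
qed

lemma cone_link_iff:
  fixes \<Gamma> :: "('a::euclidean_space \<times> real) set"
  assumes "\<Gamma> \<subseteq> {x. snd x = 1}"
  shows "x \<in> cone_link \<Gamma> \<longleftrightarrow> norm x = 1 \<and> snd x \<noteq> 0 \<and> x /\<^sub>R snd x \<in> \<Gamma>"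
proof
  assume x: "x \<in> cone_link \<Gamma>"
  then have "x \<in> cone_over \<Gamma>" "norm x = 1" by (simp_all add: cone_link_def)
  then obtain t p where p: "p \<in> \<Gamma>" "x = t *\<^sub>R p" "norm x = 1" unfolding cone_over_def by blast
  then have t: "t \<noteq> 0" "snd p = 1" using assms by auto
  then show "norm x = 1 \<and> snd x \<noteq> 0 \<and> x /\<^sub>R snd x \<in> \<Gamma>" using p by simp
next
  assume x: "norm x = 1 \<and> snd x \<noteq> 0 \<and> x /\<^sub>R snd x \<in> \<Gamma>"
  then have "x = snd x *\<^sub>R (x /\<^sub>R snd x)" by simp
  with x have "x \<in> cone_over \<Gamma>" unfolding cone_over_def by blast
  with x show "x \<in> cone_link \<Gamma>" by (simp add: cone_link_def)
qed

text \<open>On either side of the hyperplane \<open>snd x = 0\<close> the map \<open>x \<mapsto> (\<parallel>x\<parallel> / snd x) *\<^sub>R x\<close> rescales the unit sphere to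
the hyperplane \<open>snd x = 1\<close>, thus the link to \<open>\<Gamma>\<close>.  It is injective in the radial direction too, because
its last coordinate is \<open>\<parallel>x\<parallel>\<close>; so it is a diffeomorphism onto the half space \<open>snd x > 0\<close>, whereas the
plain projection \<open>x /\<^sub>R snd x\<close> would lose a dimension.\<close>
lemma Ck_submanifold_cone_link:
  fixes \<Gamma> :: "('a::euclidean_space \<times> real) set"
  assumes \<Gamma>: "Ck_submanifold k n \<Gamma>" and hyp: "\<Gamma> \<subseteq> {x. snd x = 1}"
  shows "Ck_submanifold k n (cone_link \<Gamma>)"
proof (rule Ck_submanifold_local_diffeo[OF \<Gamma>])
  fix p assume p: "p \<in> cone_link \<Gamma>"
  \<comment> \<open>The link contains \<open>-x\<close> with \<open>x\<close>; \<open>\<epsilon>\<close> tells on which side of \<open>snd x = 0\<close> the point \<open>p\<close> lies.\<close>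
  define \<epsilon> :: real where "\<epsilon> = sgn (snd p)"
  have \<epsilon>: "\<epsilon> * \<epsilon> = 1" "\<epsilon> * snd p > 0" "\<epsilon> \<noteq> 0" "\<bar>\<epsilon>\<bar> = 1"
    using p cone_link_iff[OF hyp] by (auto simp: \<epsilon>_def sgn_if)
  define A :: "('a \<times> real) set" where "A = {x. 0 < \<epsilon> * snd x}"
  define B :: "('a \<times> real) set" where "B = {x. 0 < snd x}"
  define \<phi> where "\<phi> x = (norm x * inverse (snd x)) *\<^sub>R x" for x :: "'a \<times> real"
  define \<psi> where "\<psi> y = (\<epsilon> * (snd y * inverse (norm y))) *\<^sub>R y" for y :: "'a \<times> real"
  have A: "open A" and B: "open B"
    unfolding A_def B_def by (auto intro!: open_Collect_less continuous_intros)
  have A0: "0 \<notin> A" "\<And>x. x \<in> A \<Longrightarrow> snd x \<noteq> 0" and B0: "0 \<notin> B" by (auto simp: A_def B_def)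
  have lin: "Ck_on k snd W" "Ck_on k (\<lambda>x. x) W" if "open W" for W :: "('a \<times> real) set"
    by (intro Ck_on_bounded_linear that bounded_linear_snd bounded_linear_ident)+
  have inv: "Ck_on k (\<lambda>x. inverse (h x)) W" if "open W" "Ck_on k h W" "\<And>x. x \<in> W \<Longrightarrow> h x \<noteq> 0"
    for W :: "('a \<times> real) set" and h :: "'a \<times> real \<Rightarrow> real"
    by (rule Ck_on_compose[OF that(1) _ _ Ck_on_inverse that(2)]) (use that(3) in auto)
  have C\<phi>: "Ck_on k \<phi> A"
    unfolding \<phi>_def
    by (intro Ck_on_bilinear[OF bounded_bilinear_scaleR] Ck_on_mult Ck_on_norm inv lin A A0)
  have C\<psi>: "Ck_on k \<psi> B"
    unfolding \<psi>_def
    by (intro Ck_on_bilinear[OF bounded_bilinear_scaleR] Ck_on_mult Ck_on_norm Ck_on_const inv lin B B0)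
      (auto simp: B_def)
  have \<phi>_snd: "snd (\<phi> x) = norm x" if "x \<in> A" for x using A0(2)[OF that] by (simp add: \<phi>_def)
  have \<psi>_snd: "\<epsilon> * snd (\<psi> y) = (snd y)\<^sup>2 * inverse (norm y)" for y
    using \<epsilon>(1) by (simp add: \<psi>_def power2_eq_square algebra_simps)
  have sn: "inverse (snd x) * \<bar>snd x\<bar> = \<epsilon>" "x \<noteq> 0" if "x \<in> A" for x
    using that \<epsilon> by (auto simp: A_def abs_if \<epsilon>_def sgn_if split: if_splits)
  have "\<psi> (\<phi> x) = x" if x: "x \<in> A" for x
  proof -
    have n: "norm (\<phi> x) = norm x * (inverse \<bar>snd x\<bar> * norm x)" by (simp add: \<phi>_def abs_mult)
    have "\<psi> (\<phi> x) = (\<epsilon> * (norm x * inverse (norm x * (inverse \<bar>snd x\<bar> * norm x)))) *\<^sub>R \<phi> x"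
      by (simp only: \<psi>_def \<phi>_snd[OF x] n)
    also have "\<dots> = (\<epsilon> * (norm x * inverse (norm x * (inverse \<bar>snd x\<bar> * norm x))) * (norm x * inverse (snd x))) *\<^sub>R x"
      by (simp only: \<phi>_def scaleR_scaleR)
    also have "\<epsilon> * (norm x * inverse (norm x * (inverse \<bar>snd x\<bar> * norm x))) * (norm x * inverse (snd x)) = 1"
      using sn[OF x] A0(2)[OF x] \<epsilon> by (simp add: field_simps)
    finally show ?thesis by simp
  qed
  moreover have "\<phi> (\<psi> y) = y" if y: "y \<in> B" for y
  proof -
    have y': "snd y > 0" "y \<noteq> 0" using y by (auto simp: B_def)
    have n: "norm (\<psi> y) = snd y" using y' \<epsilon>(4) by (simp add: \<psi>_def abs_mult)
    have sd: "snd (\<psi> y) = \<epsilon> * (snd y * inverse (norm y)) * snd y" by (simp add: \<psi>_def)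
    have "\<phi> (\<psi> y) = (snd y * inverse (\<epsilon> * (snd y * inverse (norm y)) * snd y)) *\<^sub>R \<psi> y"
      by (simp only: \<phi>_def n sd)
    also have "\<dots> = (snd y * inverse (\<epsilon> * (snd y * inverse (norm y)) * snd y) * (\<epsilon> * (snd y * inverse (norm y)))) *\<^sub>R y"
      by (simp only: \<psi>_def scaleR_scaleR)
    also have "snd y * inverse (\<epsilon> * (snd y * inverse (norm y)) * snd y) * (\<epsilon> * (snd y * inverse (norm y))) = 1"
      using y' \<epsilon>(3) by (simp add: field_simps)
    finally show ?thesis by simp
  qed
  moreover have "\<phi> ` A \<subseteq> B" using \<phi>_snd sn(2) by (auto simp: B_def)
  moreover have "\<psi> ` B \<subseteq> A"
  proof (intro image_subsetI)
    fix y assume "y \<in> B"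
    then have "snd y > 0" "norm y > 0" by (auto simp: B_def)
    then show "\<psi> y \<in> A" by (simp add: A_def \<psi>_snd)
  qed
  moreover have "x \<in> cone_link \<Gamma> \<longleftrightarrow> \<phi> x \<in> \<Gamma>" if x: "x \<in> A" for x
  proof
    assume "x \<in> cone_link \<Gamma>"
    then show "\<phi> x \<in> \<Gamma>" using cone_link_iff[OF hyp] by (simp add: \<phi>_def)
  next
    assume *: "\<phi> x \<in> \<Gamma>"
    then have "norm x = 1" using \<phi>_snd[OF x] hyp by auto
    with * show "x \<in> cone_link \<Gamma>" using A0(2)[OF x] cone_link_iff[OF hyp] by (simp add: \<phi>_def)
  qed
  moreover have "p \<in> A" using \<epsilon> by (simp add: A_def)
  ultimately show "\<exists>A B \<phi> \<psi>. open A \<and> open B \<and> p \<in> A \<and> \<phi> ` A \<subseteq> B \<and> \<psi> ` B \<subseteq> A \<and>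
      (\<forall>x\<in>A. \<psi> (\<phi> x) = x) \<and> (\<forall>y\<in>B. \<phi> (\<psi> y) = y) \<and> Ck_on k \<phi> A \<and> Ck_on k \<psi> B \<and>
      (\<forall>x\<in>A. x \<in> cone_link \<Gamma> \<longleftrightarrow> \<phi> x \<in> \<Gamma>)"
    using A B C\<phi> C\<psi> by (intro exI[of _ A] exI[of _ B] exI[of _ \<phi>] exI[of _ \<psi>] conjI ballI)
qed

text \<open>The link consists of the normalized points of \<open>\<Gamma>\<close> and their antipodes.\<close>
lemma compact_cone_link:
  fixes \<Gamma> :: "('a::euclidean_space \<times> real) set"
  assumes \<Gamma>: "compact \<Gamma>" and hyp: "\<Gamma> \<subseteq> {x. snd x = 1}"
  shows "compact (cone_link \<Gamma>)"
proof -
  define \<nu> where "\<nu> p = p /\<^sub>R norm p" for p :: "'a \<times> real"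
  have nz: "p \<noteq> 0" "snd p = 1" if "p \<in> \<Gamma>" for p using that hyp by auto
  have cont: "continuous_on \<Gamma> \<nu>" unfolding \<nu>_def using nz by (intro continuous_intros) auto
  have "cone_link \<Gamma> = \<nu> ` \<Gamma> \<union> uminus ` \<nu> ` \<Gamma>"
  proof (intro equalityI subsetI)
    fix x assume "x \<in> cone_link \<Gamma>"
    then have x: "norm x = 1" "snd x \<noteq> 0" "x /\<^sub>R snd x \<in> \<Gamma>" using cone_link_iff[OF hyp] by auto
    have "\<nu> (x /\<^sub>R snd x) = sgn (snd x) *\<^sub>R x" using x(1,2) by (simp add: \<nu>_def sgn_div_norm divide_simps)
    then have "x = \<nu> (x /\<^sub>R snd x) \<or> x = - \<nu> (x /\<^sub>R snd x)" using x(2) by (auto simp: sgn_if)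
    with x(3) show "x \<in> \<nu> ` \<Gamma> \<union> uminus ` \<nu> ` \<Gamma>" by blast
  next
    fix x assume "x \<in> \<nu> ` \<Gamma> \<union> uminus ` \<nu> ` \<Gamma>"
    then obtain p where p: "p \<in> \<Gamma>" "x = \<nu> p \<or> x = - \<nu> p" by auto
    then have "norm x = 1 \<and> snd x \<noteq> 0 \<and> x /\<^sub>R snd x = p" using nz[OF p(1)] by (auto simp: \<nu>_def)
    then show "x \<in> cone_link \<Gamma>" using p(1) cone_link_iff[OF hyp] by auto
  qed
  moreover have "compact (uminus ` \<nu> ` \<Gamma>)"
    by (rule compact_negations[OF compact_continuous_image[OF cont \<Gamma>]])
  ultimately show ?thesis using compact_continuous_image[OF cont \<Gamma>] by (simp add: compact_Un)
qed

lemma closed_Ck_submanifold_cone_link: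
  fixes \<Gamma> :: "('a::euclidean_space \<times> real) set"
  assumes "closed_Ck_submanifold k n \<Gamma>" "\<Gamma> \<subseteq> {x. snd x = 1}"
  shows "closed_Ck_submanifold k n (cone_link \<Gamma>)"
  using assms compact_cone_link Ck_submanifold_cone_link unfolding closed_Ck_submanifold_def by blast

section \<open>Geodesics of the cone and their radial projection\<close>

lemma cone_over_scaleR:
  assumes "x \<in> cone_over \<Gamma>" shows "r *\<^sub>R x \<in> cone_over \<Gamma>"
proof -
  obtain t p where "p \<in> \<Gamma>" "x = t *\<^sub>R p" using assms unfolding cone_over_def by blast
  then have "p \<in> \<Gamma>" "r *\<^sub>R x = (r * t) *\<^sub>R p" by simp_all
  then show ?thesis unfolding cone_over_def by blast
qed

lemma tangent_vectors_mono: "M \<subseteq> M' \<Longrightarrow> w \<in> tangent_vectors M p \<Longrightarrow> w \<in> tangent_vectors M' p"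
  unfolding tangent_vectors_def by blast

lemma has_real_derivative_inner:
  assumes "(c has_vector_derivative v) (at s)" "(d has_vector_derivative w) (at s)"
  shows "((\<lambda>t. c t \<bullet> d t) has_real_derivative v \<bullet> d s + c s \<bullet> w) (at s)"
  using bounded_bilinear.has_vector_derivative[OF bounded_bilinear_inner assms]
  by (simp add: has_real_derivative_iff_has_vector_derivative add.commute)

lemma DERIV_unique_nhds:
  fixes f :: "real \<Rightarrow> real"
  assumes "(f has_real_derivative D) (at s)" "(g has_real_derivative E) (at s)"
    "eventually (\<lambda>t. f t = g t) (nhds s)"
  shows "D = E"
  using has_vector_derivative_cong_nhds[OF assms(1)[unfolded has_real_derivative_iff_has_vector_derivative] assms(3)]
    assms(2) vector_derivative_unique_at
  unfolding has_real_derivative_iff_has_vector_derivative by blast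

lemma tangent_vectors_sphere_inner:
  fixes x :: "'a::real_inner"
  assumes "w \<in> tangent_vectors (sphere 0 1) x"
  shows "x \<bullet> w = 0"
proof -
  obtain c where c: "c 0 = x" "(c has_vector_derivative w) (at 0)"
    "eventually (\<lambda>t. c t \<in> sphere 0 1) (nhds (0::real))"
    using assms by (rule tangent_vectorsE)
  have "w \<bullet> c 0 + c 0 \<bullet> w = 0"
    by (rule DERIV_unique_nhds[OF has_real_derivative_inner[OF c(2,2)] DERIV_const[of 1]])
      (rule eventually_mono[OF c(3)], simp add: norm_eq_1)
  then show ?thesis using c(1) by (simp add: inner_commute)
qed

lemma tangent_vectors_cone_radial:
  assumes "x \<in> cone_over \<Gamma>" shows "x \<in> tangent_vectors (cone_over \<Gamma>) x"
proof -
  have "((\<lambda>t. (1 + t) *\<^sub>R x) has_vector_derivative x) (at 0)"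
    by (auto intro!: derivative_eq_intros)
  from tangent_vectorsI_open[OF this open_UNIV] show ?thesis
    using cone_over_scaleR[OF assms] by simp
qed

lemma tangent_vectors_cone_scaleR:
  assumes "w \<in> tangent_vectors (cone_over \<Gamma>) x"
  shows "r *\<^sub>R w \<in> tangent_vectors (cone_over \<Gamma>) (r *\<^sub>R x)"
proof -
  obtain c where c: "c 0 = x" "(c has_vector_derivative w) (at 0)"
    "eventually (\<lambda>t. c t \<in> cone_over \<Gamma>) (nhds (0::real))"
    using assms by (rule tangent_vectorsE)
  have "((\<lambda>t. r *\<^sub>R c t) has_vector_derivative r *\<^sub>R w) (at 0)"
    by (rule has_vector_derivative_compose[OF c(2)]) (auto intro!: derivative_eq_intros)
  from tangent_vectorsI[OF this eventually_mono[OF c(3) cone_over_scaleR]] show ?thesis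
    by (simp add: c(1))
qed

lemma cone_link_normalize:
  "x \<in> cone_over \<Gamma> \<Longrightarrow> x \<noteq> 0 \<Longrightarrow> sgn x \<in> cone_link \<Gamma>"
  using cone_over_scaleR[of x \<Gamma> "inverse (norm x)"] by (simp add: cone_link_def sgn_div_norm norm_sgn)

lemma has_vector_derivative_sgn:
  fixes c :: "real \<Rightarrow> 'a::real_inner"
  assumes c: "(c has_vector_derivative w) (at s)" and nz: "c s \<noteq> 0"
  shows "((\<lambda>t. sgn (c t)) has_vector_derivative (w - (w \<bullet> sgn (c s)) *\<^sub>R sgn (c s)) /\<^sub>R norm (c s)) (at s)"
proof -
  have "((\<lambda>t. norm (c t)) has_vector_derivative w \<bullet> sgn (c s)) (at s)"
    by (rule has_vector_derivative_compose[OF c has_derivative_norm[OF nz]])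
  then have "((\<lambda>t. inverse (norm (c t))) has_real_derivative - (inverse (norm (c s)) * (w \<bullet> sgn (c s)) * inverse (norm (c s)))) (at s)"
    using nz by (intro DERIV_inverse') (auto simp: has_real_derivative_iff_has_vector_derivative)
  from has_vector_derivative_scaleR[OF this c]
  show ?thesis
    by (simp add: sgn_div_norm algebra_simps)
qed

text \<open>Normalizing a curve in the cone gives a curve in the link; its velocity is the part of \<open>w\<close>
orthogonal to the ray, rescaled.\<close>
lemma tangent_vectors_cone_project:
  fixes x :: "'a::real_inner"
  assumes w: "w \<in> tangent_vectors (cone_over \<Gamma>) x" and nz: "x \<noteq> 0"
  shows "(w - (w \<bullet> sgn x) *\<^sub>R sgn x) /\<^sub>R norm x \<in> tangent_vectors (cone_link \<Gamma>) (sgn x)"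
proof -
  obtain c where c: "c 0 = x" "(c has_vector_derivative w) (at 0)"
    "eventually (\<lambda>t. c t \<in> cone_over \<Gamma>) (nhds (0::real))"
    using w by (rule tangent_vectorsE)
  have "eventually (\<lambda>t. c t \<in> - {0}) (nhds 0)"
    by (rule has_vector_derivative_eventually_in_open[OF c(2)]) (use nz c(1) in auto)
  with c(3) have "eventually (\<lambda>t. sgn (c t) \<in> cone_link \<Gamma>) (nhds 0)"
    by eventually_elim (auto intro: cone_link_normalize)
  from tangent_vectorsI[OF has_vector_derivative_sgn[OF c(2)] this] show ?thesis
    using nz by (simp add: c(1))
qed

lemma has_vector_derivative_reparam:
  assumes "(h has_real_derivative r) (at t)" "(x has_vector_derivative v) (at (h t))"
  shows "((\<lambda>t. x (h t)) has_vector_derivative r *\<^sub>R v) (at t)"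
  using vector_diff_chain_at[of h r t x v] assms
  by (simp add: has_real_derivative_iff_has_vector_derivative o_def)

lemma cos_pos_proj_interval: "t \<in> proj_interval \<Longrightarrow> cos t > 0"
  by (auto intro!: cos_gt_zero_pi)

locale normalized_cone_geodesic =
  fixes \<Gamma> :: "'a::euclidean_space set" and \<gamma> :: "real \<Rightarrow> 'a"
  assumes geo: "geodesic_on (cone_over \<Gamma>) UNIV \<gamma>"
    and integral_1: "cone_integral \<gamma> s = 1"
    and unit: "unit_speed_on UNIV \<gamma>"
begin

abbreviation "v \<equiv> velocity \<gamma>"
abbreviation "a \<equiv> velocity (velocity \<gamma>)"

lemma deriv: "(\<gamma> has_vector_derivative v s) (at s)" "(v has_vector_derivative a s) (at s)"
  using geodesic_onD[OF geo UNIV_I] by auto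

lemma norm_v: "norm (v s) = 1"
  using unit by (simp add: unit_speed_on_def)

lemma norm_sq: "(norm (\<gamma> s))\<^sup>2 = 1 + (\<gamma> s \<bullet> v s)\<^sup>2"
  using integral_1[of s] norm_v[of s] by (simp add: cone_integral_def)

lemma acceleration_normal: "w \<in> tangent_vectors (cone_over \<Gamma>) (\<gamma> s) \<Longrightarrow> a s \<bullet> w = 0"
  using geodesic_onD(4)[OF geo UNIV_I] by blast

lemma in_cone: "\<gamma> s \<in> cone_over \<Gamma>"
  using geodesic_onD(1)[OF geo UNIV_I] .

text \<open>The derivative of \<open>\<gamma> s \<bullet> \<gamma>' s\<close> is \<open>\<parallel>\<gamma>' s\<parallel>\<^sup>2 + \<gamma> s \<bullet> \<gamma>'' s\<close>, and the second term vanishes because the ray through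
\<open>\<gamma> s\<close> lies in the cone.\<close>
lemma ex_tangency_parameter: "\<exists>s0. \<forall>s. \<gamma> s \<bullet> v s = s - s0"
proof -
  have "((\<lambda>s. \<gamma> s \<bullet> v s - s) has_real_derivative 0) (at s)" for s
  proof -
    have "\<gamma> s \<bullet> a s = 0"
      using acceleration_normal[OF tangent_vectors_cone_radial[OF in_cone[of s]]] by (simp add: inner_commute)
    moreover have "v s \<bullet> v s = 1" using norm_v[of s] by (simp add: norm_eq_1)
    ultimately show ?thesis
      using has_real_derivative_inner[OF deriv(1) deriv(2), of s] by (auto intro!: derivative_eq_intros)
  qed
  then have const: "\<gamma> s \<bullet> v s - s = \<gamma> 0 \<bullet> v 0 - 0" for s
    using DERIV_isconst_all[of "\<lambda>s. \<gamma> s \<bullet> v s - s" s 0] by blast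
  show ?thesis
  proof (intro exI allI)
    show "\<gamma> s \<bullet> v s = s - (- (\<gamma> 0 \<bullet> v 0))" for s using const[of s] by linarith
  qed
qed

text \<open>Only at \<open>s0\<close> is the norm \<open>1\<close>.  There the normalized curve on the sphere has the same velocity
as \<open>\<gamma>\<close>, which exhibits this velocity as a tangent vector of the sphere.\<close>
lemma tangent_to_sphere_iff:
  assumes s0: "\<And>s. \<gamma> s \<bullet> v s = s - s0"
  shows "tangent_to_sphere_at \<gamma> s \<longleftrightarrow> s = s0"
proof
  assume "tangent_to_sphere_at \<gamma> s"
  then have "norm (\<gamma> s) = 1" by (simp add: tangent_to_sphere_at_def)
  then show "s = s0" using norm_sq[of s] s0[of s] by simp
next
  assume s: "s = s0"
  have nz: "\<gamma> t \<noteq> 0" for t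
    using norm_sq[of t] by (metis add_pos_nonneg norm_zero power_zero_numeral zero_le_power2 zero_less_one less_irrefl)
  have "norm (\<gamma> s) = 1 \<or> norm (\<gamma> s) = - 1" using norm_sq[of s] s0[of s] s by (simp add: power2_eq_1_iff)
  then have n1: "norm (\<gamma> s) = 1" using norm_ge_zero[of "\<gamma> s"] by linarith
  then have sg: "sgn (\<gamma> s) = \<gamma> s" by (simp add: sgn_div_norm)
  have "v s \<bullet> \<gamma> s = 0" using s0[of s] s by (simp add: inner_commute)
  then have "((\<lambda>t. sgn (\<gamma> t)) has_vector_derivative v s) (at s)"
    using has_vector_derivative_sgn[OF deriv(1)[of s] nz] by (simp add: sg n1)
  from tangent_vectorsI_open[OF this open_UNIV, of "sphere 0 1"]
  show "tangent_to_sphere_at \<gamma> s"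
    using n1 nz by (simp add: tangent_to_sphere_at_def sg norm_sgn)
qed

end

locale normalized_cone_geodesic_at = normalized_cone_geodesic +
  fixes s0 :: real
  assumes inner_v: "\<gamma> s \<bullet> velocity \<gamma> s = s - s0"
begin

lemma norm_\<gamma>: "norm (\<gamma> s) = sqrt (1 + (s - s0)\<^sup>2)"
  using norm_sq[of s] inner_v[of s] by (metis norm_ge_zero real_sqrt_unique)

text \<open>The projection and its first two derivatives in closed form.  The factor \<open>cos t\<close> is the inverse norm
of \<open>\<gamma>\<close> at \<open>s0 + tan t\<close>.\<close>
definition proj where "proj t = cos t *\<^sub>R \<gamma> (s0 + tan t)"
definition proj_v where "proj_v t = - sin t *\<^sub>R \<gamma> (s0 + tan t) + inverse (cos t) *\<^sub>R v (s0 + tan t)"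
definition proj_a where "proj_a t = - proj t + (inverse (cos t) ^ 3) *\<^sub>R a (s0 + tan t)"

lemma norm_\<gamma>_tan:
  assumes t: "t \<in> proj_interval" shows "norm (\<gamma> (s0 + tan t)) = inverse (cos t)"
proof -
  have c: "cos t > 0" by (rule cos_pos_proj_interval[OF t])
  have "1 + (tan t)\<^sup>2 = (inverse (cos t))\<^sup>2" using tan_sec[of t] c by simp
  then show ?thesis using c by (simp add: norm_\<gamma> real_sqrt_unique)
qed

lemma radial_projection_eq:
  assumes t: "t \<in> proj_interval" shows "radial_projection \<gamma> s0 t = proj t"
  by (simp add: radial_projection_def proj_def norm_\<gamma>_tan[OF t])

lemma proj_deriv:
  assumes t: "t \<in> proj_interval"
  shows "(proj has_vector_derivative proj_v t) (at t)" "(proj_v has_vector_derivative proj_a t) (at t)"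
proof -
  have c: "cos t > 0" by (rule cos_pos_proj_interval[OF t])
  then have tan: "((\<lambda>t. s0 + tan t) has_real_derivative inverse ((cos t)\<^sup>2)) (at t)"
    by (auto intro!: derivative_eq_intros)
  note g = has_vector_derivative_reparam[OF tan deriv(1)] and gv = has_vector_derivative_reparam[OF tan deriv(2)]
  have cos: "(cos has_real_derivative - sin t) (at t)" and sin: "((\<lambda>t. - sin t) has_real_derivative - cos t) (at t)"
    and inv: "((\<lambda>t. inverse (cos t)) has_real_derivative sin t * inverse ((cos t)\<^sup>2)) (at t)"
    using c by (auto intro!: derivative_eq_intros simp: power2_eq_square)
  show "(proj has_vector_derivative proj_v t) (at t)"
    unfolding proj_def[abs_def] proj_v_def
    by (rule has_vector_derivative_eq_rhs[OF has_vector_derivative_scaleR[OF cos g]])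
      (use c in \<open>simp add: power2_eq_square\<close>)
  show "(proj_v has_vector_derivative proj_a t) (at t)"
    unfolding proj_v_def[abs_def] proj_a_def proj_def
    by (rule has_vector_derivative_eq_rhs[OF has_vector_derivative_add[OF
          has_vector_derivative_scaleR[OF sin g] has_vector_derivative_scaleR[OF inv gv]]])
      (use c in \<open>simp add: power2_eq_square power3_eq_cube ac_simps\<close>)
qed

text \<open>A vector tangent to the link is orthogonal to the position on the sphere, which removes
the first term of \<open>proj_a\<close>, and it is tangent to the cone along the whole ray, which removes the second.\<close>
lemma radial_projection_geodesic:
  "geodesic_on (cone_link \<Gamma>) proj_interval (radial_projection \<gamma> s0)"
proof (rule geodesic_on_cong[of _ _ proj])
  show "geodesic_on (cone_link \<Gamma>) proj_interval proj"
  proof (rule geodesic_onI[where ?c1.0 = proj_v and ?c2.0 = proj_a])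
    fix t assume t: "t \<in> proj_interval"
    have c: "cos t > 0" by (rule cos_pos_proj_interval[OF t])
    show "proj t \<in> cone_link \<Gamma>"
      using cone_over_scaleR[OF in_cone] norm_\<gamma>_tan[OF t] c by (simp add: proj_def cone_link_def)
    show "(proj has_vector_derivative proj_v t) (at t)" "(proj_v has_vector_derivative proj_a t) (at t)"
      by (rule proj_deriv[OF t])+
    fix w assume w: "w \<in> tangent_vectors (cone_link \<Gamma>) (proj t)"
    have "proj t \<bullet> w = 0"
      by (rule tangent_vectors_sphere_inner, rule tangent_vectors_mono[OF _ w]) (simp add: cone_link_def)
    moreover have "a (s0 + tan t) \<bullet> (inverse (cos t) *\<^sub>R w) = 0"
    proof (rule acceleration_normal)
      have "w \<in> tangent_vectors (cone_over \<Gamma>) (proj t)"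
        by (rule tangent_vectors_mono[OF _ w]) (simp add: cone_link_def)
      from tangent_vectors_cone_scaleR[OF this, of "inverse (cos t)"]
      show "inverse (cos t) *\<^sub>R w \<in> tangent_vectors (cone_over \<Gamma>) (\<gamma> (s0 + tan t))"
        using c by (simp add: proj_def)
    qed
    ultimately show "proj_a t \<bullet> w = 0" using c by (simp add: proj_a_def inner_diff_left inner_add_left)
  next
    have ne: "cos t \<noteq> 0" if "t \<in> proj_interval" for t using cos_pos_proj_interval[OF that] by simp
    have tan: "continuous_on proj_interval (\<lambda>t. s0 + tan t)"
      using ne by (intro continuous_intros) auto
    have "continuous_on proj_interval (\<lambda>t. a (s0 + tan t))"
      by (rule continuous_on_compose2[OF geodesic_on_continuous_acceleration[OF geo] tan]) auto
    moreover have "continuous_on proj_interval proj"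
      using proj_deriv(1) has_vector_derivative_continuous by (blast intro: continuous_at_imp_continuous_on)
    ultimately show "continuous_on proj_interval proj_a"
      unfolding proj_a_def[abs_def] using ne by (intro continuous_intros) auto
  qed simp
qed (use radial_projection_eq in auto)

lemma velocity_radial_projection:
  assumes t: "t \<in> proj_interval" shows "velocity (radial_projection \<gamma> s0) t = proj_v t"
  by (rule velocity_eqI, rule has_vector_derivative_transform_within_open[OF proj_deriv(1)[OF t] _ t])
    (use radial_projection_eq in auto)

lemma radial_projection_unit_speed: "unit_speed_on proj_interval (radial_projection \<gamma> s0)"
  unfolding unit_speed_on_def
proof
  fix t assume t: "t \<in> proj_interval"
  have c: "cos t > 0" by (rule cos_pos_proj_interval[OF t])
  let ?g = "\<gamma> (s0 + tan t)" and ?v = "v (s0 + tan t)"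
  have i: "?g \<bullet> ?g = (inverse (cos t))\<^sup>2" "?v \<bullet> ?v = 1" "?g \<bullet> ?v = tan t"
    using norm_\<gamma>_tan[OF t] norm_v[of "s0 + tan t"] inner_v[of "s0 + tan t"]
    by (simp_all add: power2_norm_eq_inner[symmetric] norm_eq_1)
  have "proj_v t \<bullet> proj_v t
      = (sin t)\<^sup>2 * (?g \<bullet> ?g) - 2 * (sin t * inverse (cos t)) * (?g \<bullet> ?v) + (inverse (cos t))\<^sup>2 * (?v \<bullet> ?v)"
    by (simp add: proj_v_def inner_diff_left inner_diff_right inner_add_left inner_add_right inner_commute
        power2_eq_square algebra_simps)
  also have "\<dots> = (1 - (sin t)\<^sup>2) / (cos t)\<^sup>2"
    unfolding i using c by (simp add: tan_def field_simps power2_eq_square)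
  also have "\<dots> = 1" using c by (simp add: cos_squared_eq[symmetric])
  finally show "norm (velocity (radial_projection \<gamma> s0) t) = 1"
    by (simp add: velocity_radial_projection[OF t] norm_eq_1)
qed

text \<open>With \<open>t = arctan (s - s0)\<close> the direction of \<open>\<gamma> s\<close> is \<open>\<sigma> t\<close>, and solving the formula for \<open>proj_v\<close> for the
velocity of \<open>\<gamma>\<close> expresses it through \<open>\<sigma>\<close> and its velocity.  Both expressions are
continuous in \<open>t\<close> up to \<open>\<plusminus> pi / 2\<close>, where \<open>cos\<close> vanishes and \<open>sin\<close> is \<open>\<plusminus> 1\<close>.\<close>
lemma
  assumes ext: "complete_geodesic_extension (cone_link \<Gamma>) proj_interval (radial_projection \<gamma> s0) \<sigma>"
  shows direction_tendsto:
      "((\<lambda>s. \<gamma> s /\<^sub>R norm (\<gamma> s)) \<longlongrightarrow> \<sigma> (pi / 2)) at_top"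
      "((\<lambda>s. \<gamma> s /\<^sub>R norm (\<gamma> s)) \<longlongrightarrow> \<sigma> (- (pi / 2))) at_bot"
    and velocity_tendsto:
      "(v \<longlongrightarrow> \<sigma> (pi / 2)) at_top" "(v \<longlongrightarrow> - \<sigma> (- (pi / 2))) at_bot"
    and limits_in_cone: "\<sigma> (pi / 2) \<in> cone_over \<Gamma>" "- \<sigma> (- (pi / 2)) \<in> cone_over \<Gamma>"
proof -
  define \<theta> where "\<theta> s = arctan (s - s0)" for s
  have \<theta>: "\<theta> s \<in> proj_interval" "s0 + tan (\<theta> s) = s" for s
    using arctan_lbound[of "s - s0"] arctan_ubound[of "s - s0"] by (auto simp: \<theta>_def tan_arctan)
  have geo\<sigma>: "geodesic_on (cone_link \<Gamma>) UNIV \<sigma>"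
    and eq: "\<And>t. t \<in> proj_interval \<Longrightarrow> \<sigma> t = radial_projection \<gamma> s0 t"
    using ext by (auto simp: complete_geodesic_extension_def)
  have dir: "\<gamma> s /\<^sub>R norm (\<gamma> s) = \<sigma> (\<theta> s)" for s
    using eq[OF \<theta>(1)[of s]] \<theta>(2)[of s] by (simp add: radial_projection_def)
  have vel: "v s = cos (\<theta> s) *\<^sub>R velocity \<sigma> (\<theta> s) + sin (\<theta> s) *\<^sub>R \<sigma> (\<theta> s)" for s
  proof -
    have "velocity \<sigma> (\<theta> s) = proj_v (\<theta> s)"
      by (rule velocity_eqI, rule has_vector_derivative_transform_within_open[OF proj_deriv(1)[OF \<theta>(1)] _ \<theta>(1)])
        (use eq radial_projection_eq in auto)
    moreover have "\<sigma> (\<theta> s) = proj (\<theta> s)" using eq[OF \<theta>(1)] radial_projection_eq[OF \<theta>(1)] by simp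
    moreover have "cos (\<theta> s) > 0" by (rule cos_pos_proj_interval[OF \<theta>(1)])
    ultimately show ?thesis by (simp add: proj_v_def proj_def \<theta>(2) scaleR_add_right scaleR_diff_right mult.commute)
  qed
  have cont: "isCont \<sigma> b" "isCont (velocity \<sigma>) b" for b
    by (rule has_vector_derivative_continuous[OF geodesic_onD(2)[OF geo\<sigma> UNIV_I]],
        rule has_vector_derivative_continuous[OF geodesic_onD(3)[OF geo\<sigma> UNIV_I]])
  have lim: "((\<lambda>s. \<sigma> (\<theta> s)) \<longlongrightarrow> \<sigma> b) F"
    "((\<lambda>s. cos (\<theta> s) *\<^sub>R velocity \<sigma> (\<theta> s) + sin (\<theta> s) *\<^sub>R \<sigma> (\<theta> s)) \<longlongrightarrow> cos b *\<^sub>R velocity \<sigma> b + sin b *\<^sub>R \<sigma> b) F"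
    if b: "(\<theta> \<longlongrightarrow> b) F" for b F
  proof -
    have 1: "((\<lambda>s. \<sigma> (\<theta> s)) \<longlongrightarrow> \<sigma> b) F" "((\<lambda>s. velocity \<sigma> (\<theta> s)) \<longlongrightarrow> velocity \<sigma> b) F"
      by (rule isCont_tendsto_compose[OF cont(1) b], rule isCont_tendsto_compose[OF cont(2) b])
    then show "((\<lambda>s. \<sigma> (\<theta> s)) \<longlongrightarrow> \<sigma> b) F" by simp
    show "((\<lambda>s. cos (\<theta> s) *\<^sub>R velocity \<sigma> (\<theta> s) + sin (\<theta> s) *\<^sub>R \<sigma> (\<theta> s)) \<longlongrightarrow> cos b *\<^sub>R velocity \<sigma> b + sin b *\<^sub>R \<sigma> b) F"
      by (intro tendsto_intros 1 b)
  qed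
  have top: "(\<theta> \<longlongrightarrow> pi / 2) at_top"
    unfolding \<theta>_def
    by (rule filterlim_compose[OF tendsto_arctan_at_top])
      (use filterlim_tendsto_add_at_top[OF tendsto_const[of "- s0"] filterlim_ident] in simp)
  have bot: "(\<theta> \<longlongrightarrow> - (pi / 2)) at_bot"
    unfolding \<theta>_def
    by (rule filterlim_compose[OF tendsto_arctan_at_bot])
      (use filterlim_tendsto_add_at_bot_iff[OF tendsto_const[of "- s0"], of "\<lambda>s. s" at_bot] filterlim_ident in simp)
  show "((\<lambda>s. \<gamma> s /\<^sub>R norm (\<gamma> s)) \<longlongrightarrow> \<sigma> (pi / 2)) at_top"
    "((\<lambda>s. \<gamma> s /\<^sub>R norm (\<gamma> s)) \<longlongrightarrow> \<sigma> (- (pi / 2))) at_bot"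
    unfolding dir by (rule lim(1)[OF top], rule lim(1)[OF bot])
  have "v = (\<lambda>s. cos (\<theta> s) *\<^sub>R velocity \<sigma> (\<theta> s) + sin (\<theta> s) *\<^sub>R \<sigma> (\<theta> s))" using vel by auto
  then show "(v \<longlongrightarrow> \<sigma> (pi / 2)) at_top" "(v \<longlongrightarrow> - \<sigma> (- (pi / 2))) at_bot"
    using lim(2)[OF top] lim(2)[OF bot] by simp_all
  have "\<sigma> t \<in> cone_over \<Gamma>" for t
    using geodesic_onD(1)[OF geo\<sigma>, of t] by (simp add: cone_link_def)
  then show "\<sigma> (pi / 2) \<in> cone_over \<Gamma>" "- \<sigma> (- (pi / 2)) \<in> cone_over \<Gamma>"
    using cone_over_scaleR[of "\<sigma> (- (pi / 2))" \<Gamma> "- 1"] by simp_all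
qed

end

section \<open>The conical lift\<close>

text \<open>Differentiating \<open>\<delta> t \<bullet> \<delta> t = 1\<close> twice gives \<open>\<delta> t \<bullet> \<delta>' t = 0\<close> and \<open>\<delta>'' t \<bullet> \<delta> t = -1\<close>.  The second derivative
\<open>l2\<close> of the lift is a multiple of \<open>\<delta> + \<delta>''\<close>; it is orthogonal to the ray by the second identity, and to
the part of a tangent vector orthogonal to the ray because that part is tangent to the link.\<close>
lemma
  fixes \<Gamma> :: "'a::euclidean_space set"
  assumes geo: "geodesic_on (cone_link \<Gamma>) proj_interval \<delta>" and unit: "unit_speed_on proj_interval \<delta>"
  shows conical_lift_geodesic: "geodesic_on (cone_over \<Gamma>) UNIV (conical_lift \<delta>)"
    and conical_lift_unit_speed: "unit_speed_on UNIV (conical_lift \<delta>)"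
    and conical_lift_tangent: "tangent_to_sphere_at (conical_lift \<delta>) 0"
    and conical_lift_0: "conical_lift \<delta> 0 = \<delta> 0"
proof -
  define \<rho> where "\<rho> s = sqrt (s\<^sup>2 + 1)" for s :: real
  have \<rho>: "\<rho> s > 0" "(\<rho> s)\<^sup>2 = s\<^sup>2 + 1" "\<rho> s \<noteq> 0" for s
  proof -
    have "s\<^sup>2 + 1 > 0" by (simp add: add_nonneg_pos)
    then show "\<rho> s > 0" "(\<rho> s)\<^sup>2 = s\<^sup>2 + 1" "\<rho> s \<noteq> 0" by (auto simp: \<rho>_def)
  qed
  let ?d = "\<lambda>s. \<delta> (arctan s)" and ?d1 = "\<lambda>s. velocity \<delta> (arctan s)" and ?d2 = "\<lambda>s. velocity (velocity \<delta>) (arctan s)"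
  have I: "arctan s \<in> proj_interval" for s
    using arctan_lbound[of s] arctan_ubound[of s] by auto
  have sphere: "\<delta> t \<bullet> \<delta> t = 1" if "t \<in> proj_interval" for t
    using geodesic_onD(1)[OF geo that] by (simp add: cone_link_def norm_eq_1)
  have evI: "eventually (\<lambda>u. u \<in> proj_interval) (nhds t)" if "t \<in> proj_interval" for t
    using that by (intro eventually_nhds_in_open) auto
  have orth: "\<delta> t \<bullet> velocity \<delta> t = 0" if t: "t \<in> proj_interval" for t
  proof -
    have "velocity \<delta> t \<bullet> \<delta> t + \<delta> t \<bullet> velocity \<delta> t = 0"
      by (rule DERIV_unique_nhds[OF has_real_derivative_inner[OF geodesic_onD(2)[OF geo t] geodesic_onD(2)[OF geo t]]
            DERIV_const[of 1] eventually_mono[OF evI[OF t] sphere]])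
    then show ?thesis by (simp add: inner_commute)
  qed
  have d1_unit: "velocity \<delta> t \<bullet> velocity \<delta> t = 1" if "t \<in> proj_interval" for t
    using unit that by (simp add: unit_speed_on_def norm_eq_1)
  have d2_radial: "velocity (velocity \<delta>) t \<bullet> \<delta> t = - 1" if t: "t \<in> proj_interval" for t
  proof -
    have "velocity \<delta> t \<bullet> velocity \<delta> t + \<delta> t \<bullet> velocity (velocity \<delta>) t = 0"
      by (rule DERIV_unique_nhds[OF has_real_derivative_inner[OF geodesic_onD(2)[OF geo t] geodesic_onD(3)[OF geo t]]
            DERIV_const[of 0] eventually_mono[OF evI[OF t] orth]])
    then show ?thesis using d1_unit[OF t] by (simp add: inner_commute)
  qed
  have arctan: "(arctan has_real_derivative inverse ((\<rho> s)\<^sup>2)) (at s)" for s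
    using DERIV_arctan[of s] by (simp add: \<rho> add.commute)
  note D1 = has_vector_derivative_reparam[OF arctan geodesic_onD(2)[OF geo I]]
  note D2 = has_vector_derivative_reparam[OF arctan geodesic_onD(3)[OF geo I]]
  have \<rho>': "(\<rho> has_real_derivative s * inverse (\<rho> s)) (at s)" for s
  proof -
    have "s\<^sup>2 + 1 > 0" by (simp add: add_nonneg_pos)
    then show ?thesis unfolding \<rho>_def[abs_def] by (auto intro!: derivative_eq_intros simp: field_simps)
  qed
  have inv': "((\<lambda>s. inverse (\<rho> s)) has_real_derivative - s * inverse (\<rho> s) ^ 3) (at s)" for s
    using DERIV_inverse'[OF \<rho>' \<rho>(3), of s] by (simp add: power3_eq_cube ac_simps)
  have quot': "((\<lambda>s. s * inverse (\<rho> s)) has_real_derivative inverse (\<rho> s) ^ 3) (at s)" for s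
  proof -
    have "1 * inverse (\<rho> s) + (- s * inverse (\<rho> s) ^ 3) * s = ((\<rho> s)\<^sup>2 - s\<^sup>2) * inverse (\<rho> s) ^ 3"
      using \<rho>(3)[of s] by (simp add: field_simps power2_eq_square power3_eq_cube)
    also have "\<dots> = inverse (\<rho> s) ^ 3" by (simp add: \<rho>(2))
    finally show ?thesis using DERIV_mult'[OF DERIV_ident inv', of s] by (simp add: ac_simps)
  qed
  define l1 where "l1 s = (s * inverse (\<rho> s)) *\<^sub>R ?d s + inverse (\<rho> s) *\<^sub>R ?d1 s" for s
  define l2 where "l2 s = (inverse (\<rho> s) ^ 3) *\<^sub>R (?d s + ?d2 s)" for s
  have lift: "conical_lift \<delta> = (\<lambda>s. \<rho> s *\<^sub>R ?d s)"
    by (simp add: fun_eq_iff conical_lift_def \<rho>_def)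
  have L1: "(conical_lift \<delta> has_vector_derivative l1 s) (at s)" for s
    unfolding lift l1_def
    by (rule has_vector_derivative_eq_rhs[OF has_vector_derivative_scaleR[OF \<rho>' D1]])
      (use \<rho>(3)[of s] in \<open>simp add: power2_eq_square\<close>)
  have L2: "(l1 has_vector_derivative l2 s) (at s)" for s
    unfolding l1_def[abs_def] l2_def
    by (rule has_vector_derivative_eq_rhs[OF has_vector_derivative_add[OF
          has_vector_derivative_scaleR[OF quot' D1] has_vector_derivative_scaleR[OF inv' D2]]])
      (use \<rho>(3)[of s] in \<open>simp add: power2_eq_square power3_eq_cube algebra_simps\<close>)
  have sgn: "sgn (conical_lift \<delta> s) = ?d s" "norm (conical_lift \<delta> s) = \<rho> s" for s
    using sphere[OF I[of s]] \<rho>(1,3)[of s] by (simp_all add: lift sgn_div_norm norm_eq_1[symmetric])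
  show "geodesic_on (cone_over \<Gamma>) UNIV (conical_lift \<delta>)"
  proof (rule geodesic_onI[where ?c1.0 = l1 and ?c2.0 = l2])
    fix s :: real
    show "conical_lift \<delta> s \<in> cone_over \<Gamma>"
      using geodesic_onD(1)[OF geo I[of s]] by (simp add: lift cone_link_def cone_over_scaleR)
    fix w assume w: "w \<in> tangent_vectors (cone_over \<Gamma>) (conical_lift \<delta> s)"
    have "conical_lift \<delta> s \<noteq> 0" using sgn(2)[of s] \<rho>(3)[of s] by auto
    from tangent_vectors_cone_project[OF w this]
    have "?d2 s \<bullet> ((w - (w \<bullet> ?d s) *\<^sub>R ?d s) /\<^sub>R \<rho> s) = 0"
      unfolding sgn by (rule geodesic_onD(4)[OF geo I])
    then have "?d2 s \<bullet> w = (w \<bullet> ?d s) * (?d2 s \<bullet> ?d s)"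
      using \<rho>(3)[of s] by (simp add: inner_diff_right)
    then show "l2 s \<bullet> w = 0"
      using d2_radial[OF I[of s]] by (simp add: l2_def inner_add_left inner_commute[of w])
  next
    have at: "continuous_on UNIV arctan" by (intro continuous_intros)
    have "continuous_on UNIV ?d2"
      by (rule continuous_on_compose2[OF geodesic_on_continuous_acceleration[OF geo] at]) (use I in auto)
    moreover have "continuous_on UNIV ?d"
      using D1 has_vector_derivative_continuous by (blast intro: continuous_at_imp_continuous_on)
    moreover have "continuous_on UNIV \<rho>" unfolding \<rho>_def by (intro continuous_intros)
    ultimately show "continuous_on UNIV l2"
      unfolding l2_def[abs_def] using \<rho>(3) by (intro continuous_intros) auto
  qed (use L1 L2 in auto)
  have v: "velocity (conical_lift \<delta>) s = l1 s" for s by (rule velocity_eqI[OF L1])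
  have "l1 s \<bullet> l1 s = 1" for s
  proof -
    have "l1 s \<bullet> l1 s = (s * inverse (\<rho> s))\<^sup>2 * (?d s \<bullet> ?d s) + 2 * (s * inverse (\<rho> s) * inverse (\<rho> s)) * (?d s \<bullet> ?d1 s)
        + (inverse (\<rho> s))\<^sup>2 * (?d1 s \<bullet> ?d1 s)"
      by (simp add: l1_def inner_add_left inner_add_right inner_commute power2_eq_square algebra_simps)
    also have "\<dots> = (s\<^sup>2 + 1) * (inverse (\<rho> s))\<^sup>2"
      unfolding sphere[OF I] orth[OF I] d1_unit[OF I] by (simp add: power_mult_distrib algebra_simps)
    also have "\<dots> = 1" using \<rho>(3)[of s] by (simp add: \<rho>(2)[symmetric] power_inverse)
    finally show ?thesis .
  qed
  then show "unit_speed_on UNIV (conical_lift \<delta>)" by (simp add: unit_speed_on_def v norm_eq_1)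
  show at0: "conical_lift \<delta> 0 = \<delta> 0" by (simp add: conical_lift_def)
  have I0: "(0 :: real) \<in> proj_interval" by simp
  have "velocity \<delta> 0 \<in> tangent_vectors (sphere 0 1) (\<delta> 0)"
    by (rule tangent_vectors_mono[OF _ geodesic_on_velocity_tangent[OF geo open_greaterThanLessThan I0]])
      (simp add: cone_link_def)
  moreover have "velocity (conical_lift \<delta>) 0 = velocity \<delta> 0" by (simp add: v l1_def \<rho>_def)
  ultimately show "tangent_to_sphere_at (conical_lift \<delta>) 0"
    using sphere[of 0] by (simp add: tangent_to_sphere_at_def at0 norm_eq_1)
qed

section \<open>Geodesics of the cone and of its link\<close>

theorem lemma2:
  fixes \<Gamma> :: "((real ^ 'N) \<times> real) set" and n :: nat
  assumes "closed_Ck_submanifold 3 n \<Gamma>"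
    and "\<Gamma> \<subseteq> {x. snd x = 1}"
    and "n < CARD('N)"
  shows
    "(\<forall>\<gamma>. geodesic_on (cone_over \<Gamma>) UNIV \<gamma> \<and> \<not> radial \<Gamma> \<gamma> \<and>
          (\<forall>s. cone_integral \<gamma> s = 1) \<and> unit_speed_on UNIV \<gamma> \<longrightarrow>
        (\<exists>!s0. tangent_to_sphere_at \<gamma> s0) \<and>
        (\<forall>s0. tangent_to_sphere_at \<gamma> s0 \<longrightarrow>
           geodesic_on (cone_link \<Gamma>) proj_interval (radial_projection \<gamma> s0) \<and>
           unit_speed_on proj_interval (radial_projection \<gamma> s0) \<and>
           (\<exists>\<sigma>. complete_geodesic_extension (cone_link \<Gamma>) proj_interval
                   (radial_projection \<gamma> s0) \<sigma>) \<and>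
           (\<forall>\<sigma>. complete_geodesic_extension (cone_link \<Gamma>) proj_interval
                   (radial_projection \<gamma> s0) \<sigma> \<longrightarrow>
              (velocity \<gamma> \<longlongrightarrow> \<sigma> (pi / 2)) at_top \<and>
              ((\<lambda>s. \<gamma> s /\<^sub>R norm (\<gamma> s)) \<longlongrightarrow> \<sigma> (pi / 2)) at_top \<and>
              \<sigma> (pi / 2) \<in> cone_over \<Gamma> \<and>
              (velocity \<gamma> \<longlongrightarrow> - \<sigma> (- (pi / 2))) at_bot \<and>
              ((\<lambda>s. \<gamma> s /\<^sub>R norm (\<gamma> s)) \<longlongrightarrow> \<sigma> (- (pi / 2))) at_bot \<and>
              - \<sigma> (- (pi / 2)) \<in> cone_over \<Gamma>))) \<and>
     (\<forall>\<delta>. geodesic_on (cone_link \<Gamma>) proj_interval \<delta> \<and> unit_speed_on proj_interval \<delta> \<longrightarrow>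
        geodesic_on (cone_over \<Gamma>) UNIV (conical_lift \<delta>) \<and>
        unit_speed_on UNIV (conical_lift \<delta>) \<and>
        tangent_to_sphere_at (conical_lift \<delta>) 0 \<and>
        conical_lift \<delta> 0 = \<delta> 0)"
proof (rule conjI; intro allI impI)
  fix \<gamma>
  assume \<gamma>: "geodesic_on (cone_over \<Gamma>) UNIV \<gamma> \<and> \<not> radial \<Gamma> \<gamma> \<and>
    (\<forall>s. cone_integral \<gamma> s = 1) \<and> unit_speed_on UNIV \<gamma>"
  then interpret normalized_cone_geodesic \<Gamma> \<gamma> by unfold_locales auto
  obtain s1 where s1: "\<And>s. \<gamma> s \<bullet> velocity \<gamma> s = s - s1" using ex_tangency_parameter by blast
  have tangent_iff: "tangent_to_sphere_at \<gamma> s \<longleftrightarrow> s = s1" for s by (rule tangent_to_sphere_iff[OF s1])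
  interpret normalized_cone_geodesic_at \<Gamma> \<gamma> s1 by unfold_locales (rule s1)
  have "\<exists>\<sigma>. complete_geodesic_extension (cone_link \<Gamma>) proj_interval (radial_projection \<gamma> s1) \<sigma>"
    by (rule closed_submanifold_geodesically_complete[OF closed_Ck_submanifold_cone_link[OF assms(1,2)]
          radial_projection_geodesic radial_projection_unit_speed]) simp
  then show "(\<exists>!s0. tangent_to_sphere_at \<gamma> s0) \<and>
        (\<forall>s0. tangent_to_sphere_at \<gamma> s0 \<longrightarrow>
           geodesic_on (cone_link \<Gamma>) proj_interval (radial_projection \<gamma> s0) \<and>
           unit_speed_on proj_interval (radial_projection \<gamma> s0) \<and>
           (\<exists>\<sigma>. complete_geodesic_extension (cone_link \<Gamma>) proj_interval
                   (radial_projection \<gamma> s0) \<sigma>) \<and>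
           (\<forall>\<sigma>. complete_geodesic_extension (cone_link \<Gamma>) proj_interval
                   (radial_projection \<gamma> s0) \<sigma> \<longrightarrow>
              (velocity \<gamma> \<longlongrightarrow> \<sigma> (pi / 2)) at_top \<and>
              ((\<lambda>s. \<gamma> s /\<^sub>R norm (\<gamma> s)) \<longlongrightarrow> \<sigma> (pi / 2)) at_top \<and>
              \<sigma> (pi / 2) \<in> cone_over \<Gamma> \<and>
              (velocity \<gamma> \<longlongrightarrow> - \<sigma> (- (pi / 2))) at_bot \<and>
              ((\<lambda>s. \<gamma> s /\<^sub>R norm (\<gamma> s)) \<longlongrightarrow> \<sigma> (- (pi / 2))) at_bot \<and>
              - \<sigma> (- (pi / 2)) \<in> cone_over \<Gamma>))"
    unfolding tangent_iff
    using radial_projection_geodesic radial_projection_unit_speed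
      direction_tendsto velocity_tendsto limits_in_cone
    by (intro conjI allI impI) (blast | hypsubst)+
next
  fix \<delta>
  assume \<delta>: "geodesic_on (cone_link \<Gamma>) proj_interval \<delta> \<and> unit_speed_on proj_interval \<delta>"
  then show "geodesic_on (cone_over \<Gamma>) UNIV (conical_lift \<delta>) \<and>
        unit_speed_on UNIV (conical_lift \<delta>) \<and>
        tangent_to_sphere_at (conical_lift \<delta>) 0 \<and>
        conical_lift \<delta> 0 = \<delta> 0"
    using conical_lift_geodesic conical_lift_unit_speed conical_lift_tangent conical_lift_0 by blast
qed

end
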